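(* Assume that $(p,q)$ is in one of the following three cases: $1<p,q<+\infty$; $p=1$ and $1\leq q<+\infty$; or $p=\infty$ and $1\leq q\leq+\infty$. Then there is a constant $C=C(p,q)>0$ such that $$\rho_{p,q}\big(f'(z)(1-|z|)\big)\leq C\,\rho_{p,q}(f)\qquad\text{for all } f\in RM(p,q).$$
   Context: $\mathbb{D}$ is the open unit disc of $\mathbb{C}$ and $\mathcal{H}(\mathbb{D})$ the space of analytic functions on $\mathbb{D}$. For measurable $h:\mathbb{D}\to\mathbb{C}$ set $$\rho_{p,q}(h)=\Big(\frac{1}{2\pi}\int_0^{2\pi}\Big(\int_0^1|h(re^{it})|^p\,dr\Big)^{q/p}dt\Big)^{1/q}\ (p,q<+\infty),$$ $$\rho_{\infty,q}(h)=\Big(\frac{1}{2\pi}\int_0^{2\pi}\big(\operatorname{ess\,sup}_{r\in[0,1)}|h(re^{it})|\big)^{q}dt\Big)^{1/q}\ (q<+\infty),\qquad \rho_{\infty,\infty}(h)=\operatorname{ess\,sup}_{z\in\mathbb{D}}|h(z)|$$ (essential suprema are suprema for continuous $h$). $RM(p,q)=\{f\in\mathcal{H}(\mathbb{D}):\rho_{p,q}(f)<+\infty\}$. Here $\rho_{p,q}(f'(z)(1-|z|))$ denotes $\rho_{p,q}$ of the function $z\mapsto f'(z)(1-|z|)$. *)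

theory Defs
  imports "HOL-Complex_Analysis.Complex_Analysis" "HOL-Probability.Essential_Supremum"
begin

text \<open>Real powers of extended nonnegative numbers, meant for exponents \<open>a > 0\<close>:
  \<open>\<infinity>\<close> to the power \<open>a\<close> is \<open>\<infinity>\<close>, and \<open>0\<close> to the power \<open>a\<close> is \<open>0\<close>.\<close>

definition ennpowr :: "ennreal \<Rightarrow> real \<Rightarrow> ennreal" where
  "ennpowr x a = (if x = \<infinity> then \<infinity> else ennreal (enn2real x powr a))"

text \<open>The \<open>L\<^sup>p\<close> norm of \<open>h\<close> along the radius with angle \<open>t\<close>.
  Note that the library's \<^const>\<open>esssup\<close> is \<open>\<infinity>\<close> on non-measurable functions;
  restricting to \<open>{0..<1}\<close> means that only values of \<open>h\<close> in the open unit disc matter.\<close>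

definition radial_norm :: "ennreal \<Rightarrow> (complex \<Rightarrow> complex) \<Rightarrow> real \<Rightarrow> ennreal" where
  "radial_norm p h t =
    (if p = \<infinity> then esssup (lebesgue_on {0..<1::real}) (\<lambda>r. ennreal (cmod (h (of_real r * cis t))))
     else ennpowr (\<integral>\<^sup>+r. ennreal (cmod (h (of_real r * cis t)) powr enn2real p) \<partial>lebesgue_on {0..<1::real})
            (1 / enn2real p))"

text \<open>The exponents range over \<open>(0, \<infinity>]\<close>.  For \<open>p = q = \<infinity>\<close> the essential supremum is taken with
  respect to area measure on the disc.  The combination \<open>p < \<infinity> = q\<close>, which the main statement
  does not involve, is given its usual meaning so that the function is defined for all exponents.\<close>

definition rho :: "ennreal \<Rightarrow> ennreal \<Rightarrow> (complex \<Rightarrow> complex) \<Rightarrow> ennreal" where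
  "rho p q h =
    (if q < \<infinity> then
       ennpowr (ennreal (1 / (2 * pi)) *
           (\<integral>\<^sup>+t. ennpowr (radial_norm p h t) (enn2real q) \<partial>lebesgue_on {0..2 * pi}))
         (1 / enn2real q)
     else if p = \<infinity> then esssup (lebesgue_on (ball (0::complex) 1)) (\<lambda>z. ennreal (cmod (h z)))
     else esssup (lebesgue_on {0..2 * pi}) (radial_norm p h))"

definition RM :: "ennreal \<Rightarrow> ennreal \<Rightarrow> (complex \<Rightarrow> complex) set" where
  "RM p q = {f. f holomorphic_on ball 0 1 \<and> rho p q f < \<infinity>}"

end

theory Submission
  imports Defs
begin

text \<open>Put \<open>d = 1 - r\<close>. Cauchy's formula on the circle of radius \<open>(1 + r) / 2\<close> gives
  \<open>d |f'(r e\<^sup>i\<^sup>t)| \<le> C \<integral> |f((1 + r) / 2 e\<^sup>i\<^sup>y)| d / (d\<^sup>2 + (y - t)\<^sup>2) dy\<close>, so for finite \<open>p\<close> it is enough to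
  bound this averaging operator on \<open>L\<^sup>q(L\<^sup>p)\<close>. The operator is symmetric, and its kernel is dominated by the
  Hardy--Littlewood maximal function; Jensen's inequality and duality with a weight \<open>w\<close>, whose averages
  are at most \<open>16 M w\<close>, settle \<open>p \<le> q\<close>, and a second duality reduces \<open>q < p\<close> to the conjugate exponents.
  For \<open>p = \<infinity>\<close> this argument would lose \<open>q = 1\<close>. There one bounds \<open>d |f'|\<close> by a tangential maximal
  function \<open>N\<close> of \<open>f\<close> and proves \<open>N \<le> C (M (G powr (1/2)))\<^sup>2\<close> for the radial maximal function \<open>G\<close>;
  the maximal theorem is then only needed in \<open>L\<^sup>2\<^sup>q\<close>, and \<open>2 q > 1\<close>.
  To avoid periodicity, functions of the angle are cut off to \<open>[-\<pi>, 3\<pi>]\<close> and everything happens on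
  the real line.\<close>

subsection \<open>Powers of extended nonnegative numbers\<close>

text \<open>The width of the kernel varies with the radius, so no scalar inequality applies directly
  to the norms along rays. What helps is a bound that does not see the width: an average of a weight
  \<open>w\<close> of the angle is at most 16 M w, whatever the width is. Once the average has been
  moved onto the weight, this single function leaves the integral over the radius, and only scalar
  functions of the angle remain. For p = q = 1 the weight is the constant 1 and the mass of the
  kernel suffices, although the maximal theorem fails on L^1.

  All integrals are taken in \<open>ennreal\<close>, so that Tonelli's theorem needs no
  integrability. The price is that an argument dividing by a power of the quantity to be estimated
  must first know it to be finite. This happens three times: in the two dualities, where
  \<open>trunc\<close> provides finiteness, and for N, where f is replaced by a dilation z \<mapsto>
  f(\<rho> z) with \<rho> < 1. The constants are explicit but not optimised.\<close>

lemma ennpowr_ennreal: "0 \<le> x \<Longrightarrow> ennpowr (ennreal x) a = ennreal (x powr a)"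
  by (simp add: ennpowr_def)

lemma ennpowr_top [simp]: "ennpowr top a = top"
  by (simp add: ennpowr_def)

lemma ennpowr_0 [simp]: "ennpowr 0 a = 0"
  by (simp add: ennpowr_def)

lemma ennpowr_one [simp]: "ennpowr x 1 = x"
  by (cases x) (auto simp: ennpowr_ennreal)

lemma ennpowr_eq_0_iff [simp]: "ennpowr x a = 0 \<longleftrightarrow> x = 0"
  by (cases x) (auto simp: ennpowr_ennreal)

lemma ennpowr_eq_top_iff [simp]: "ennpowr x a = top \<longleftrightarrow> x = top"
  by (cases x) (auto simp: ennpowr_ennreal)

lemma ennpowr_mult: "ennpowr (x * y) a = ennpowr x a * ennpowr y a"
proof (cases "x = top \<or> y = top")
  case True
  then show ?thesis
    by (cases "x = 0 \<or> y = 0") (auto simp: ennreal_top_mult ennreal_mult_top)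
next
  case False
  then obtain a b where "x = ennreal a" "y = ennreal b" "a \<ge> 0" "b \<ge> 0"
    by (metis ennreal_cases)
  then show ?thesis
    by (simp add: ennpowr_ennreal powr_mult flip: ennreal_mult)
qed

lemma ennpowr_ennpowr: "ennpowr (ennpowr x a) b = ennpowr x (a * b)"
  by (cases x) (auto simp: ennpowr_ennreal powr_powr)

text \<open>The conventions give 0 at 0 and \<open>top\<close> at \<open>top\<close> for every real
  exponent, so negative and zero exponents are covered. The test function \<open>h\<close> for
  decreasing exponents needs a negative one.\<close>

lemma ennpowr_add: "ennpowr x (a + b) = ennpowr x a * ennpowr x b"
  by (cases x) (auto simp: ennpowr_ennreal powr_add ennreal_top_mult simp flip: ennreal_mult)

lemma ennpowr_mono: "x \<le> y \<Longrightarrow> 0 \<le> a \<Longrightarrow> ennpowr x a \<le> ennpowr y a"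
  by (cases x; cases y) (auto simp: ennpowr_ennreal powr_mono2 top_unique)

lemma ennpowr_less_top_iff [simp]: "ennpowr x a < top \<longleftrightarrow> x < top"
  by (metis ennpowr_eq_top_iff less_top)

lemma measurable_ennpowr [measurable]: "(\<lambda>x. ennpowr x a) \<in> borel_measurable borel"
  unfolding ennpowr_def by measurable

section \<open>Young's and Hoelder's inequalities, and absorption of powers\<close>

lemma ennpowr_Young:
  assumes "p > 1" "q > 1" "1/p + 1/q = 1"
  shows "x * y \<le> ennreal (1/p) * ennpowr x p + ennreal (1/q) * ennpowr y q"
proof (cases "x = top \<or> y = top")
  case True
  then show ?thesis
    using assms by (auto simp: ennreal_mult_top)
next
  case False
  then obtain a b where "x = ennreal a" "y = ennreal b" "a \<ge> 0" "b \<ge> 0"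
    by (metis ennreal_cases)
  then show ?thesis
    using Youngs_inequality[of p q a b] assms
    by (simp add: ennpowr_ennreal flip: ennreal_mult ennreal_plus)
qed

text \<open>Young's inequality for \<open>u\<close> and \<open>v\<close> divided by their norms.
  Degenerate cases are kept apart because \<open>0 * top = 0\<close>: a vanishing norm makes the
  product vanish almost everywhere, and otherwise an infinite norm makes the right side
  \<open>top\<close>.\<close>

lemma nn_integral_Holder:
  assumes pq: "p > 1" "q > 1" "1/p + 1/q = 1"
    and [measurable]: "u \<in> borel_measurable M" "v \<in> borel_measurable M"
  shows "(\<integral>\<^sup>+x. u x * v x \<partial>M)
    \<le> ennpowr (\<integral>\<^sup>+x. ennpowr (u x) p \<partial>M) (1/p) * ennpowr (\<integral>\<^sup>+x. ennpowr (v x) q \<partial>M) (1/q)"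
proof -
  define A where "A = (\<integral>\<^sup>+x. ennpowr (u x) p \<partial>M)"
  define B where "B = (\<integral>\<^sup>+x. ennpowr (v x) q \<partial>M)"
  consider "A = 0 \<or> B = 0" | "A \<noteq> 0" "B \<noteq> 0" "A = top \<or> B = top"
    | a b where "A = ennreal a" "B = ennreal b" "0 < a" "0 < b"
    by (metis ennreal_0 ennreal_cases order_less_le)
  then have "(\<integral>\<^sup>+x. u x * v x \<partial>M) \<le> ennpowr A (1/p) * ennpowr B (1/q)"
  proof cases
    case 1
    then have "AE x in M. u x * v x = 0"
      unfolding A_def B_def by (auto simp: nn_integral_0_iff_AE)
    then show ?thesis
      using nn_integral_0_iff_AE[of "\<lambda>x. u x * v x" M] by auto
  next
    case 2
    then show ?thesis
      by (auto simp: ennreal_mult_top ennreal_top_mult)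
  next
    case 3
    \<comment> \<open>\<open>c\<close> and \<open>d\<close> are the two norms. The quotients have
      norm 1, so the integrated Young bound is \<open>c * d * (1/p + 1/q)\<close>, which is
      \<open>c * d\<close>.\<close>
    define c where "c = a powr (1/p)"
    define d where "d = b powr (1/q)"
    have c: "c > 0" "c powr p = a" and d: "d > 0" "d powr q = b"
      using 3 pq by (auto simp: c_def d_def powr_powr)
    have "u x * v x \<le> ennreal (c*d) * (ennreal (1/p/a) * ennpowr (u x) p + ennreal (1/q/b) * ennpowr (v x) q)" for x
    proof -
      have "ennreal (c*d) * ((ennreal (1/c) * u x) * (ennreal (1/d) * v x))
          = (ennreal (c*d) * ennreal (1/c) * ennreal (1/d)) * (u x * v x)"
        by (simp only: ac_simps)
      also have "ennreal (c*d) * ennreal (1/c) * ennreal (1/d) = 1"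
        using c d by (simp flip: ennreal_mult)
      finally have "u x * v x = ennreal (c*d) * ((ennreal (1/c) * u x) * (ennreal (1/d) * v x))"
        by simp
      also have "\<dots> \<le> ennreal (c*d) * (ennreal (1/p) * ennpowr (ennreal (1/c) * u x) p
          + ennreal (1/q) * ennpowr (ennreal (1/d) * v x) q)"
        by (intro mult_left_mono ennpowr_Young pq) simp
      also have "ennreal (1/p) * ennpowr (ennreal (1/c) * u x) p = ennreal (1/p/a) * ennpowr (u x) p"
      proof -
        have "ennreal (1/p) * ennpowr (ennreal (1/c)) p = ennreal (1/p/a)"
          using c pq 3 by (simp add: ennpowr_ennreal powr_divide flip: ennreal_mult)
        then show ?thesis
          by (simp add: ennpowr_mult flip: mult.assoc)
      qed
      also have "ennreal (1/q) * ennpowr (ennreal (1/d) * v x) q = ennreal (1/q/b) * ennpowr (v x) q"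
      proof -
        have "ennreal (1/q) * ennpowr (ennreal (1/d)) q = ennreal (1/q/b)"
          using d pq 3 by (simp add: ennpowr_ennreal powr_divide flip: ennreal_mult)
        then show ?thesis
          by (simp add: ennpowr_mult flip: mult.assoc)
      qed
      finally show ?thesis .
    qed
    then have "(\<integral>\<^sup>+x. u x * v x \<partial>M) \<le> (\<integral>\<^sup>+x. ennreal (c*d) * (ennreal (1/p/a) * ennpowr (u x) p + ennreal (1/q/b) * ennpowr (v x) q) \<partial>M)"
      by (intro nn_integral_mono) auto
    also have "\<dots> = ennreal (c*d) * (ennreal (1/p/a) * A + ennreal (1/q/b) * B)"
      by (simp add: nn_integral_cmult nn_integral_add A_def B_def)
    also have "ennreal (1/p/a) * A + ennreal (1/q/b) * B = ennreal (1/p + 1/q)"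
    proof -
      have "ennreal (1/p/a) * A = ennreal (1/p)" "ennreal (1/q/b) * B = ennreal (1/q)"
        using 3 pq(1,2) by (simp_all flip: ennreal_mult)
      then show ?thesis
        using pq(1,2) by simp
    qed
    also have "\<dots> = 1"
      unfolding pq(3) by simp
    also have "ennreal (c * d) * 1 = ennpowr A (1/p) * ennpowr B (1/q)"
      using 3 by (simp add: ennpowr_ennreal c_def d_def ennreal_mult)
    finally show ?thesis .
  qed
  then show ?thesis by (simp add: A_def B_def)
qed

text \<open>Dividing by \<open>ennpowr X (1 - 1/R)\<close> leaves \<open>ennpowr X (1/R)\<close> on
  the left. For \<open>X = top\<close> the inequality would hold with every positive
  \<open>K\<close>, so finiteness must be known beforehand; this is why the duality arguments
  truncate.\<close>

lemma ennpowr_absorb: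
  assumes "R > 0" and X: "X < top" "X \<le> K * ennpowr X (1 - 1/R)"
  shows "X \<le> ennpowr K R"
proof (cases "X = 0 \<or> K = top")
  case False
  then obtain x k where xk: "X = ennreal x" "K = ennreal k" "x > 0" "k \<ge> 0"
    using X(1) by (metis ennreal_0 ennreal_cases less_top order_less_le)
  then have "x \<le> k * x powr (1 - 1/R)"
    using X(2) by (simp add: ennpowr_ennreal flip: ennreal_mult)
  also have "\<dots> = k * x / x powr (1/R)"
    using xk by (simp add: powr_diff)
  finally have "x powr (1/R) \<le> k"
    using xk by (simp add: field_simps)
  then have "(x powr (1/R)) powr R \<le> k powr R"
    using assms by (intro powr_mono2) auto
  then show ?thesis
    using xk assms by (simp add: powr_powr ennpowr_ennreal)
qed auto

section \<open>The layer-cake formula for powers\<close>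

lemma ennreal_unbounded_eq_top:
  assumes "\<And>c. c \<ge> 0 \<Longrightarrow> ennreal c \<le> x"
  shows "x = top"
proof (cases x)
  case (real r)
  then show ?thesis
    using assms[of "r + 1"] by simp
qed

text \<open>For finite \<open>X\<close> this is the antiderivative of a power, integrable at 0
  because \<open>a > 0\<close>; an infinite \<open>X\<close> is exhausted from below. It is the
  inner integral of the layer-cake formula.\<close>

lemma nn_integral_powr_less:
  assumes a: "a > 0"
  shows "(\<integral>\<^sup>+x. ennreal (x powr (a - 1)) * indicator {x. 0 < x \<and> ennreal x < X} x \<partial>lborel)
    = ennreal (1/a) * ennpowr X a"
proof -
  have fin: "(\<integral>\<^sup>+x. ennreal (x powr (a - 1)) * indicator {x. 0 < x \<and> ennreal x < ennreal c} x \<partial>lborel)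
      = ennreal (1/a) * ennpowr (ennreal c) a" if c: "c \<ge> 0" for c
  proof -
    have "(\<integral>\<^sup>+x. ennreal (x powr (a - 1)) * indicator {x. 0 < x \<and> ennreal x < ennreal c} x \<partial>lborel)
        = (\<integral>\<^sup>+x. indicator {0..c} x * (x powr (a - 1)) \<partial>lborel)"
    proof (rule nn_integral_cong_AE)
      have "AE x in lborel. x \<noteq> c"
        by (rule AE_lborel_singleton)
      then show "AE x in lborel. ennreal (x powr (a - 1)) * indicator {x. 0 < x \<and> ennreal x < ennreal c} x
          = ennreal (indicator {0..c} x * (x powr (a - 1)))"
      proof eventually_elim
        case (elim x)
        then show ?case
          by (cases "x = 0") (auto simp: indicator_def ennreal_less_iff)
      qed
    qed
    also have "\<dots> = c powr (a - 1 + 1) / (a - 1 + 1)"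
      by (intro nn_integral_has_integral_lebesgue has_integral_powr_from_0) (use a c in auto)
    finally show ?thesis
      using a c by (simp add: ennpowr_ennreal flip: ennreal_mult)
  qed
  show ?thesis
  proof (cases X)
    case top
    let ?I = "(\<integral>\<^sup>+x. ennreal (x powr (a - 1)) * indicator {x. 0 < x \<and> ennreal x < X} x \<partial>lborel)"
    have "ennreal c \<le> ?I" if c: "c \<ge> 0" for c
    proof -
      \<comment> \<open>Chosen so that the finite case at level \<open>d\<close> gives exactly
        \<open>c\<close>.\<close>
      define d where "d = (a * c) powr (1/a)"
      have "ennreal c = ennreal (1/a) * ennpowr (ennreal d) a"
        using a c by (simp add: d_def ennpowr_ennreal powr_powr flip: ennreal_mult)
      also have "\<dots> \<le> ?I"
        unfolding top
        by (subst fin[symmetric]) (auto simp: d_def indicator_def intro!: nn_integral_mono)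
      finally show ?thesis .
    qed
    then have "?I = top"
      by (rule ennreal_unbounded_eq_top)
    then show ?thesis
      using a by (simp add: top ennreal_mult_top)
  qed (use fin in auto)
qed

subsection \<open>The Hardy--Littlewood maximal function\<close>

text \<open>The uncentred maximal function: the ball need only contain \<open>t\<close>. Hence its
  superlevel sets are unions of balls, open whatever \<open>W\<close> is, and it is always Borel
  measurable. In dimension one \<open>2 * d\<close> is the length of the ball.\<close>

definition maximal_fun :: "(real \<Rightarrow> ennreal) \<Rightarrow> real \<Rightarrow> ennreal" where
  "maximal_fun W t = (SUP (x, d) \<in> {(x, d). 0 < d \<and> t \<in> ball x d}.
     ennreal (1 / (2 * d)) * (\<integral>\<^sup>+y\<in>ball x d. W y \<partial>lborel))"

lemma pred_mem_ball [measurable]: "Measurable.pred borel (\<lambda>x. x \<in> ball a r)"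
  by (simp add: pred_def borel_open del: mem_ball)

lemma emeasure_lborel_ball_real: "d \<ge> 0 \<Longrightarrow> emeasure lborel (ball x d :: real set) = ennreal (2 * d)"
  by (simp add: ball_eq_greaterThanLessThan)

lemma maximal_fun_upper:
  assumes "0 < d" "t \<in> ball x d"
  shows "(\<integral>\<^sup>+y\<in>ball x d. W y \<partial>lborel) \<le> ennreal (2 * d) * maximal_fun W t"
proof -
  have "ennreal (1 / (2 * d)) * (\<integral>\<^sup>+y\<in>ball x d. W y \<partial>lborel) \<le> maximal_fun W t"
    unfolding maximal_fun_def by (rule SUP_upper2[of "(x, d)"]) (use assms in auto)
  then have "ennreal (2 * d) * (ennreal (1 / (2 * d)) * (\<integral>\<^sup>+y\<in>ball x d. W y \<partial>lborel))
      \<le> ennreal (2 * d) * maximal_fun W t"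
    by (rule mult_left_mono) simp
  moreover have "ennreal (2 * d) * ennreal (1 / (2 * d)) = 1"
    using assms by (simp flip: ennreal_mult)
  ultimately show ?thesis
    by (simp flip: mult.assoc)
qed

lemma maximal_fun_less_iff:
  "l < maximal_fun W t \<longleftrightarrow>
    (\<exists>x d. 0 < d \<and> t \<in> ball x d \<and> l < ennreal (1 / (2 * d)) * (\<integral>\<^sup>+y\<in>ball x d. W y \<partial>lborel))"
  unfolding maximal_fun_def by (auto simp: less_SUP_iff)

lemma open_maximal_fun_superlevel: "open {t. l < maximal_fun W t}"
proof -
  have "{t. l < maximal_fun W t} = (\<Union>(x, d) \<in> {(x, d). 0 < d \<and>
      l < ennreal (1 / (2 * d)) * (\<integral>\<^sup>+y\<in>ball x d. W y \<partial>lborel)}. ball x d)"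
    by (fastforce simp: maximal_fun_less_iff)
  then show ?thesis by auto
qed

lemma measurable_maximal_fun [measurable]: "maximal_fun W \<in> borel_measurable borel"
  by (rule borel_measurableI_greater) (simp add: open_maximal_fun_superlevel borel_open)

text \<open>Vitali's covering lemma selects disjoint balls, on each of which \<open>W\<close> has
  mass at least \<open>l\<close> times the length, and whose fivefold enlargements cover the
  superlevel set. A finite integral of \<open>W\<close> bounds the radii, as the covering lemma
  requires; an infinite one makes the claim trivial.\<close>

lemma maximal_fun_weak_type:
  assumes [measurable]: "W \<in> borel_measurable borel" and l: "l > 0"
  shows "ennreal l * emeasure lborel {t. ennreal l < maximal_fun W t} \<le> 5 * (\<integral>\<^sup>+y. W y \<partial>lborel)"
proof (cases "\<integral>\<^sup>+y. W y \<partial>lborel")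
  case (real I)
  define K where "K = {(x, d). 0 < d \<and> ennreal l < ennreal (1 / (2 * d)) * (\<integral>\<^sup>+y\<in>ball x d. W y \<partial>lborel)}"
  have K: "0 < snd i \<and> ennreal (2 * snd i * l) \<le> (\<integral>\<^sup>+y\<in>ball (fst i) (snd i). W y \<partial>lborel)" if "i \<in> K" for i
  proof -
    obtain x d where i: "i = (x, d)" by force
    have d: "d > 0" and "ennreal l \<le> ennreal (1 / (2 * d)) * (\<integral>\<^sup>+y\<in>ball x d. W y \<partial>lborel)"
      using that by (auto simp: K_def i)
    then have "ennreal (2 * d) * ennreal l \<le> ennreal (2 * d) * (ennreal (1 / (2 * d)) * (\<integral>\<^sup>+y\<in>ball x d. W y \<partial>lborel))"
      by (intro mult_left_mono) auto
    moreover have "ennreal (2 * d) * ennreal (1 / (2 * d)) = 1"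
      using d by (simp flip: ennreal_mult)
    ultimately show ?thesis
      using d l by (simp add: i ennreal_mult flip: mult.assoc)
  qed
  have bnd: "snd i \<le> I / (2 * l)" if "i \<in> K" for i
  proof -
    have "ennreal (2 * snd i * l) \<le> (\<integral>\<^sup>+y\<in>ball (fst i) (snd i). W y \<partial>lborel)"
      using K[OF that] by simp
    also have "\<dots> \<le> ennreal I"
      unfolding real(2)[symmetric] by (intro nn_integral_mono) (auto simp: indicator_def)
    finally have "2 * snd i * l \<le> I"
      using real by simp
    then show ?thesis
      using l by (simp add: field_simps)
  qed
  have sub: "{t. ennreal l < maximal_fun W t} \<subseteq> (\<Union>i\<in>K. ball (fst i) (snd i))"
    by (fastforce simp: maximal_fun_less_iff K_def)
  obtain C where C: "countable C" "C \<subseteq> K"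
      "pairwise (\<lambda>i j. disjnt (ball (fst i) (snd i)) (ball (fst j) (snd j))) C"
      "{t. ennreal l < maximal_fun W t} \<subseteq> (\<Union>i\<in>C. ball (fst i) (5 * snd i))"
    by (rule Vitali_covering_lemma_balls[OF sub, of "I / (2 * l)"]) (use K bnd in auto)
  \<comment> \<open>Disjointness keeps the sum of the indicators below 1, so the balls together see
    no more than the whole integral of \<open>W\<close>. Sums over the countable family are
    integrals over \<open>count_space C\<close>.\<close>
  have sum1: "(\<integral>\<^sup>+i. indicator (ball (fst i) (snd i)) y \<partial>count_space C) \<le> (1::ennreal)" for y
  proof (cases "\<exists>j\<in>C. y \<in> ball (fst j) (snd j)")
    case True
    then obtain j where j: "j \<in> C" "y \<in> ball (fst j) (snd j)" by blast
    have "i = j" if "i \<in> C" "y \<in> ball (fst i) (snd i)" for i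
      using C(3) that j unfolding pairwise_def disjnt_iff by metis
    then have "(\<integral>\<^sup>+i. indicator (ball (fst i) (snd i)) y \<partial>count_space C)
        \<le> (\<integral>\<^sup>+i. indicator {j} i \<partial>count_space C)"
      by (intro nn_integral_mono) (auto simp: indicator_def)
    also have "\<dots> = 1"
      using j by (simp add: nn_integral_indicator)
    finally show ?thesis .
  next
    case False
    then have "(\<integral>\<^sup>+i. indicator (ball (fst i) (snd i)) y \<partial>count_space C) = (\<integral>\<^sup>+i. 0 \<partial>count_space C)"
      by (intro nn_integral_cong) auto
    then show ?thesis by simp
  qed
  have "emeasure lborel {t. ennreal l < maximal_fun W t} \<le> emeasure lborel (\<Union>i\<in>C. ball (fst i) (5 * snd i))"
    by (intro emeasure_mono C(4)) (auto intro!: borel_open)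
  also have "\<dots> = (\<integral>\<^sup>+y. indicator (\<Union>i\<in>C. ball (fst i) (5 * snd i)) y \<partial>lborel)"
    by (rule nn_integral_indicator[symmetric]) (auto intro!: borel_open)
  also have "\<dots> \<le> (\<integral>\<^sup>+y. \<integral>\<^sup>+i. indicator (ball (fst i) (5 * snd i)) y \<partial>count_space C \<partial>lborel)"
  proof (intro nn_integral_mono)
    fix y
    show "indicator (\<Union>i\<in>C. ball (fst i) (5 * snd i)) y
        \<le> (\<integral>\<^sup>+i. indicator (ball (fst i) (5 * snd i)) y \<partial>count_space C :: ennreal)"
    proof (cases "\<exists>j\<in>C. y \<in> ball (fst j) (5 * snd j)")
      case True
      then obtain j where j: "j \<in> C" "y \<in> ball (fst j) (5 * snd j)" by blast
      have "1 = (\<integral>\<^sup>+i. indicator {j} i \<partial>count_space C)"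
        using j by (simp add: nn_integral_indicator)
      also have "\<dots> \<le> (\<integral>\<^sup>+i. indicator (ball (fst i) (5 * snd i)) y \<partial>count_space C)"
        using j by (intro nn_integral_mono) (auto simp: indicator_def)
      finally show ?thesis
        by (auto simp: indicator_def)
    qed (auto simp: indicator_def)
  qed
  also have "\<dots> = (\<integral>\<^sup>+i. \<integral>\<^sup>+y. indicator (ball (fst i) (5 * snd i)) y \<partial>lborel \<partial>count_space C)"
    by (intro nn_integral_count_space_nn_integral C(1)) measurable
  also have "\<dots> = (\<integral>\<^sup>+i. ennreal (10 * snd i) \<partial>count_space C)"
  proof (intro nn_integral_cong)
    fix i assume "i \<in> space (count_space C)"
    then have "i \<in> K"
      using C(2) by auto
    then have "0 < snd i"
      using K by blast
    then show "(\<integral>\<^sup>+y. indicator (ball (fst i) (5 * snd i)) y \<partial>lborel) = ennreal (10 * snd i)"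
      by (simp add: emeasure_lborel_ball_real)
  qed
  finally have "ennreal l * emeasure lborel {t. ennreal l < maximal_fun W t}
      \<le> ennreal l * (\<integral>\<^sup>+i. ennreal (10 * snd i) \<partial>count_space C)"
    by (rule mult_left_mono) simp
  also have "\<dots> = (\<integral>\<^sup>+i. ennreal l * ennreal (10 * snd i) \<partial>count_space C)"
    by (rule nn_integral_cmult[symmetric]) simp
  also have "\<dots> \<le> (\<integral>\<^sup>+i. 5 * (\<integral>\<^sup>+y. W y * indicator (ball (fst i) (snd i)) y \<partial>lborel) \<partial>count_space C)"
  proof (intro nn_integral_mono)
    fix i assume "i \<in> space (count_space C)"
    then have i: "i \<in> K" using C(2) by auto
    then have "ennreal l * ennreal (10 * snd i) = ennreal (5 * (2 * snd i * l))"
      using l K[OF i] by (simp add: mult_ac flip: ennreal_mult)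
    also have "\<dots> = ennreal 5 * ennreal (2 * snd i * l)"
      using l K[OF i] by (intro ennreal_mult) auto
    also have "\<dots> \<le> ennreal 5 * (\<integral>\<^sup>+y\<in>ball (fst i) (snd i). W y \<partial>lborel)"
      using K[OF i] by (intro mult_left_mono) auto
    finally show "ennreal l * ennreal (10 * snd i) \<le> 5 * (\<integral>\<^sup>+y. W y * indicator (ball (fst i) (snd i)) y \<partial>lborel)"
      by simp
  qed
  also have "\<dots> = 5 * (\<integral>\<^sup>+i. (\<integral>\<^sup>+y. W y * indicator (ball (fst i) (snd i)) y \<partial>lborel) \<partial>count_space C)"
    by (rule nn_integral_cmult) simp
  also have "(\<integral>\<^sup>+i. (\<integral>\<^sup>+y. W y * indicator (ball (fst i) (snd i)) y \<partial>lborel) \<partial>count_space C)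
      = (\<integral>\<^sup>+y. \<integral>\<^sup>+i. W y * indicator (ball (fst i) (snd i)) y \<partial>count_space C \<partial>lborel)"
    by (rule nn_integral_count_space_nn_integral[symmetric, OF C(1)]) measurable
  also have "\<dots> = (\<integral>\<^sup>+y. W y * (\<integral>\<^sup>+i. indicator (ball (fst i) (snd i)) y \<partial>count_space C) \<partial>lborel)"
    by (intro nn_integral_cong nn_integral_cmult) simp
  also have "\<dots> \<le> (\<integral>\<^sup>+y. W y * 1 \<partial>lborel)"
    by (intro nn_integral_mono mult_left_mono sum1) simp
  finally show ?thesis
    by (simp add: mult_left_mono)
qed (simp add: ennreal_mult_top)

text \<open>Since \<open>W\<close> is at most \<open>l\<close> plus its part above the height
  \<open>l\<close>, every average drops by at most \<open>l\<close> when only that part is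
  kept.\<close>

lemma maximal_fun_superlevel_truncate:
  assumes [measurable]: "W \<in> borel_measurable borel" and l: "l > 0"
  shows "{t. ennreal (2 * l) < maximal_fun W t}
    \<subseteq> {t. ennreal l < maximal_fun (\<lambda>y. W y * indicator {y. ennreal l < W y} y) t}"
proof
  fix t assume "t \<in> {t. ennreal (2 * l) < maximal_fun W t}"
  then obtain x d where d: "0 < d" "t \<in> ball x d"
    and less: "ennreal (2 * l) < ennreal (1 / (2 * d)) * (\<integral>\<^sup>+y\<in>ball x d. W y \<partial>lborel)"
    by (auto simp: maximal_fun_less_iff)
  let ?V = "\<lambda>y. W y * indicator {y. ennreal l < W y} y"
  have "(\<integral>\<^sup>+y\<in>ball x d. W y \<partial>lborel) \<le> (\<integral>\<^sup>+y. ennreal l * indicator (ball x d) y + ?V y * indicator (ball x d) y \<partial>lborel)"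
    by (intro nn_integral_mono) (auto simp: indicator_def)
  also have "\<dots> = ennreal l * ennreal (2 * d) + (\<integral>\<^sup>+y\<in>ball x d. ?V y \<partial>lborel)"
    using d by (subst nn_integral_add) (measurable, auto simp: nn_integral_cmult_indicator emeasure_lborel_ball_real)
  finally have "ennreal (1 / (2 * d)) * (\<integral>\<^sup>+y\<in>ball x d. W y \<partial>lborel)
      \<le> ennreal (1 / (2 * d)) * (ennreal l * ennreal (2 * d) + (\<integral>\<^sup>+y\<in>ball x d. ?V y \<partial>lborel))"
    by (rule mult_left_mono) simp
  also have "\<dots> = ennreal l + ennreal (1 / (2 * d)) * (\<integral>\<^sup>+y\<in>ball x d. ?V y \<partial>lborel)"
  proof -
    have "ennreal (1 / (2 * d)) * (ennreal l * ennreal (2 * d)) = ennreal l"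
      using d l by (simp flip: ennreal_mult)
    then show ?thesis by (simp add: distrib_left)
  qed
  finally have "ennreal l + ennreal l < ennreal l + ennreal (1 / (2 * d)) * (\<integral>\<^sup>+y\<in>ball x d. ?V y \<partial>lborel)"
    using less l by (auto simp flip: ennreal_plus)
  then have "ennreal l < ennreal (1 / (2 * d)) * (\<integral>\<^sup>+y\<in>ball x d. ?V y \<partial>lborel)"
    by simp
  then show "t \<in> {t. ennreal l < maximal_fun ?V t}"
    using d by (auto simp: maximal_fun_less_iff)
qed

text \<open>Marcinkiewicz interpolation between the weak type bound and the trivial bound for
  bounded functions. At height x only the part of \<open>W\<close> above x/2 counts; Tonelli then
  leaves the integral of x^(R-2) over 0 < x < 2 W(t), which converges at 0 because R > 1.\<close>

lemma maximal_fun_strong_type: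
  assumes W [measurable]: "W \<in> borel_measurable borel" and R: "R > 1"
  shows "(\<integral>\<^sup>+t. ennpowr (maximal_fun W t) R \<partial>lborel)
    \<le> ennreal (10 * R * 2 powr (R - 1) / (R - 1)) * (\<integral>\<^sup>+t. ennpowr (W t) R \<partial>lborel)"
proof -
  have pow: "ennpowr X R = ennreal R * (\<integral>\<^sup>+x. ennreal (x powr (R - 1)) * indicator {x. 0 < x \<and> ennreal x < X} x \<partial>lborel)" for X
    using R by (simp add: nn_integral_powr_less flip: ennreal_mult mult.assoc)
  define V where "V l = (\<lambda>y. W y * indicator {y. ennreal l < W y} y)" for l
  have [measurable]: "(\<lambda>t. maximal_fun W t) \<in> borel_measurable lborel" "W \<in> borel_measurable lborel"
    by simp_all
  have [measurable]: "V l \<in> borel_measurable borel" for l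
    unfolding V_def by measurable
  have "(\<integral>\<^sup>+t. ennpowr (maximal_fun W t) R \<partial>lborel)
      = ennreal R * (\<integral>\<^sup>+t. \<integral>\<^sup>+x. ennreal (x powr (R - 1)) * indicator {x. 0 < x \<and> ennreal x < maximal_fun W t} x \<partial>lborel \<partial>lborel)"
    unfolding pow by (rule nn_integral_cmult) measurable
  also have "(\<integral>\<^sup>+t. \<integral>\<^sup>+x. ennreal (x powr (R - 1)) * indicator {x. 0 < x \<and> ennreal x < maximal_fun W t} x \<partial>lborel \<partial>lborel)
     = (\<integral>\<^sup>+x. \<integral>\<^sup>+t. ennreal (x powr (R - 1)) * indicator {x. 0 < x \<and> ennreal x < maximal_fun W t} x \<partial>lborel \<partial>lborel)"
    by (rule lborel_pair.Fubini') measurable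
  also have "\<dots> \<le> (\<integral>\<^sup>+x. \<integral>\<^sup>+t. W t * (10 * ennreal (x powr (R - 2)) * indicator {x. 0 < x \<and> ennreal x < 2 * W t} x) \<partial>lborel \<partial>lborel)"
  proof (rule nn_integral_mono)
    fix x :: real
    show "(\<integral>\<^sup>+t. ennreal (x powr (R - 1)) * indicator {x. 0 < x \<and> ennreal x < maximal_fun W t} x \<partial>lborel)
        \<le> (\<integral>\<^sup>+t. W t * (10 * ennreal (x powr (R - 2)) * indicator {x. 0 < x \<and> ennreal x < 2 * W t} x) \<partial>lborel)"
    proof (cases "x > 0")
      case True
      have "(\<integral>\<^sup>+t. ennreal (x powr (R - 1)) * indicator {x. 0 < x \<and> ennreal x < maximal_fun W t} x \<partial>lborel)
          = (\<integral>\<^sup>+t. ennreal (x powr (R - 1)) * indicator {t. ennreal x < maximal_fun W t} t \<partial>lborel)"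
        using True by (intro nn_integral_cong) (auto simp: indicator_def)
      also have "\<dots> = ennreal (x powr (R - 1)) * emeasure lborel {t. ennreal x < maximal_fun W t}"
        by (rule nn_integral_cmult_indicator) measurable
      also have "\<dots> \<le> ennreal (x powr (R - 1)) * emeasure lborel {t. ennreal (x/2) < maximal_fun (V (x/2)) t}"
        using maximal_fun_superlevel_truncate[OF W, of "x/2"] True
        by (intro mult_left_mono emeasure_mono) (auto simp: V_def)
      \<comment> \<open>A factor \<open>x/2\<close> is split off to serve as the level in the weak
        type bound; the 10 below is 2 * 5.\<close>
      also have "\<dots> = ennreal (2 * x powr (R - 2)) * (ennreal (x/2) * emeasure lborel {t. ennreal (x/2) < maximal_fun (V (x/2)) t})"
      proof -
        have "x powr (R - 1) = 2 * x powr (R - 2) * (x/2)"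
          using True powr_add[of x "R-2" 1] by simp
        then have "ennreal (x powr (R - 1)) = ennreal (2 * x powr (R - 2)) * ennreal (x/2)"
          using True by (simp flip: ennreal_mult)
        then show ?thesis by (simp add: mult.assoc)
      qed
      also have "\<dots> \<le> ennreal (2 * x powr (R - 2)) * (5 * (\<integral>\<^sup>+y. V (x/2) y \<partial>lborel))"
        using True by (intro mult_left_mono maximal_fun_weak_type) auto
      also have "\<dots> = ennreal (10 * x powr (R - 2)) * (\<integral>\<^sup>+y. V (x/2) y \<partial>lborel)"
      proof -
        have "ennreal (10 * x powr (R - 2)) = ennreal (2 * x powr (R - 2)) * ennreal 5"
          by (subst ennreal_mult[symmetric]) auto
        then show ?thesis by (simp add: mult.assoc)
      qed
      also have "\<dots> = (\<integral>\<^sup>+y. ennreal (10 * x powr (R - 2)) * V (x/2) y \<partial>lborel)"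
        by (rule nn_integral_cmult[symmetric]) measurable
      also have "\<dots> = (\<integral>\<^sup>+t. W t * (10 * ennreal (x powr (R - 2)) * indicator {x. 0 < x \<and> ennreal x < 2 * W t} x) \<partial>lborel)"
      proof (intro nn_integral_cong)
        fix t :: real
        have "ennreal (x/2) < W t \<longleftrightarrow> ennreal x < 2 * W t"
        proof (cases "W t")
          case (real w)
          then show ?thesis using True
            by (simp add: ennreal_less_iff mult.commute flip: ennreal_numeral ennreal_mult)
        qed (auto simp: ennreal_mult_top)
        then show "ennreal (10 * x powr (R - 2)) * V (x/2) t = W t * (10 * ennreal (x powr (R - 2)) * indicator {x. 0 < x \<and> ennreal x < 2 * W t} x)"
          using True by (auto simp: V_def indicator_def ennreal_mult mult_ac)
      qed
      finally show ?thesis .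
    qed simp
  qed
  also have "\<dots> = (\<integral>\<^sup>+t. \<integral>\<^sup>+x. W t * (10 * ennreal (x powr (R - 2)) * indicator {x. 0 < x \<and> ennreal x < 2 * W t} x) \<partial>lborel \<partial>lborel)"
    by (rule lborel_pair.Fubini') measurable
  also have "\<dots> = (\<integral>\<^sup>+t. ennreal (10 * 2 powr (R - 1) / (R - 1)) * ennpowr (W t) R \<partial>lborel)"
  proof (intro nn_integral_cong)
    fix t
    have "(\<integral>\<^sup>+x. W t * (10 * ennreal (x powr (R - 2)) * indicator {x. 0 < x \<and> ennreal x < 2 * W t} x) \<partial>lborel)
        = W t * (10 * (\<integral>\<^sup>+x. ennreal (x powr ((R - 1) - 1)) * indicator {x. 0 < x \<and> ennreal x < 2 * W t} x \<partial>lborel))"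
      by (simp add: nn_integral_cmult mult.assoc)
    also have "\<dots> = W t * (10 * (ennreal (1/(R-1)) * ennpowr (2 * W t) (R - 1)))"
      using R by (subst nn_integral_powr_less) auto
    also have "\<dots> = (10 * ennreal (1/(R-1)) * ennpowr 2 (R - 1)) * (ennpowr (W t) 1 * ennpowr (W t) (R - 1))"
      by (simp add: ennpowr_mult mult_ac)
    also have "ennpowr (W t) 1 * ennpowr (W t) (R - 1) = ennpowr (W t) R"
      by (subst ennpowr_add[symmetric]) simp
    also have "10 * ennreal (1/(R-1)) * ennpowr 2 (R - 1) = ennreal (10 * 2 powr (R - 1) / (R - 1))"
      using R ennpowr_ennreal[of 2 "R-1"] by (simp flip: ennreal_mult ennreal_numeral)
    finally show "(\<integral>\<^sup>+x. W t * (10 * ennreal (x powr (R - 2)) * indicator {x. 0 < x \<and> ennreal x < 2 * W t} x) \<partial>lborel)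
        = ennreal (10 * 2 powr (R - 1) / (R - 1)) * ennpowr (W t) R" .
  qed
  also have "\<dots> = ennreal (10 * 2 powr (R - 1) / (R - 1)) * (\<integral>\<^sup>+t. ennpowr (W t) R \<partial>lborel)"
    by (rule nn_integral_cmult) measurable
  finally have "(\<integral>\<^sup>+t. ennpowr (maximal_fun W t) R \<partial>lborel)
      \<le> ennreal R * (ennreal (10 * 2 powr (R - 1) / (R - 1)) * (\<integral>\<^sup>+t. ennpowr (W t) R \<partial>lborel))"
    by (simp add: mult_left_mono)
  also have "\<dots> = ennreal (10 * R * 2 powr (R - 1) / (R - 1)) * (\<integral>\<^sup>+t. ennpowr (W t) R \<partial>lborel)"
  proof -
    have "ennreal R * ennreal (10 * 2 powr (R - 1) / (R - 1)) = ennreal (10 * R * 2 powr (R - 1) / (R - 1))"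
      using R by (simp add: mult_ac flip: ennreal_mult)
    then show ?thesis by (simp flip: mult.assoc)
  qed
  finally show ?thesis .
qed

subsection \<open>The averaging kernel\<close>

text \<open>For \<open>D > 0\<close> this is pi times the Poisson kernel of the upper half-plane at
  height \<open>D\<close>. For \<open>D \<le> 0\<close> it vanishes, since \<open>ennreal\<close>
  sends nonpositive numbers to 0.\<close>

definition poisson_ker :: "real \<Rightarrow> real \<Rightarrow> ennreal" where
  "poisson_ker D x = ennreal (D / (D\<^sup>2 + x\<^sup>2))"

lemma measurable_poisson_ker [measurable]:
  assumes [measurable]: "f \<in> borel_measurable M" "g \<in> borel_measurable M"
  shows "(\<lambda>x. poisson_ker (f x) (g x)) \<in> borel_measurable M"
  unfolding poisson_ker_def by measurable

lemma poisson_ker_minus_commute: "poisson_ker D (x - y) = poisson_ker D (y - x)"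
  by (simp add: poisson_ker_def power2_commute)

text \<open>Where |y - t| lies between 2^(j-1) D and 2^j D, the denominator is at least 4^(j-1) D^2,
  which produces 4 / (4^j D). A single term of the sum, the one with the least possible j, already
  dominates the kernel.\<close>

lemma poisson_ker_le_dyadic:
  assumes D: "D > 0"
  shows "poisson_ker D (y - t) \<le> (\<Sum>j. ennreal (4 * (1/4) ^ j / D) * indicator (ball t (2 ^ j * D)) y)"
proof -
  let ?P = "\<lambda>j::nat. \<bar>y - t\<bar> < 2 ^ j * D"
  obtain n where n: "\<bar>y - t\<bar> / D < 2 ^ n"
    using real_arch_pow[of 2 "\<bar>y - t\<bar> / D"] by auto
  then have "?P n"
    using D by (simp add: field_simps)
  define j where "j = (LEAST j. ?P j)"
  have j: "?P j"
    unfolding j_def by (rule LeastI) fact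
  have "D / (D\<^sup>2 + (y - t)\<^sup>2) \<le> 4 * (1/4) ^ j / D"
  proof (cases j)
    case 0
    have "D / (D\<^sup>2 + (y - t)\<^sup>2) \<le> D / D\<^sup>2"
      using D by (intro divide_left_mono) (auto intro!: mult_pos_pos add_pos_nonneg)
    also have "\<dots> \<le> 4 / D"
      using D by (simp add: power2_eq_square field_simps)
    finally show ?thesis
      by (simp add: 0)
  next
    case (Suc k)
    have "\<not> ?P k"
      using not_less_Least[of k ?P] Suc unfolding j_def by auto
    then have "(2 ^ k * D)\<^sup>2 \<le> \<bar>y - t\<bar>\<^sup>2"
      using D by (intro power_mono) auto
    moreover have "(2 ^ k * D)\<^sup>2 = 4 ^ k * D\<^sup>2"
    proof -
      have "(2 ^ k)\<^sup>2 = (4 ^ k :: real)"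
        by (simp add: power2_eq_square flip: power_mult_distrib)
      then show ?thesis by (simp add: power_mult_distrib)
    qed
    ultimately have "4 ^ k * D\<^sup>2 \<le> D\<^sup>2 + (y - t)\<^sup>2"
      by (simp add: add_increasing)
    then have "D / (D\<^sup>2 + (y - t)\<^sup>2) \<le> D / (4 ^ k * D\<^sup>2)"
      using D by (intro divide_left_mono) (auto intro!: mult_pos_pos add_pos_nonneg)
    also have "\<dots> = 4 * (1/4) ^ j / D"
      using D by (simp add: Suc power2_eq_square field_simps)
    finally show ?thesis .
  qed
  then have "poisson_ker D (y - t) \<le> ennreal (4 * (1/4) ^ j / D) * indicator (ball t (2 ^ j * D)) y"
    using j D by (auto simp: poisson_ker_def dist_real_def abs_minus_commute intro!: ennreal_leI)
  also have "\<dots> \<le> (\<Sum>j. ennreal (4 * (1/4) ^ j / D) * indicator (ball t (2 ^ j * D)) y)"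
  proof -
    define F where "F = (\<lambda>j. ennreal (4 * (1/4) ^ j / D) * indicator (ball t (2 ^ j * D)) y)"
    have "sum F {j} \<le> suminf F"
      by (intro sum_le_suminf) auto
    then have "F j \<le> suminf F"
      by simp
    then show ?thesis
      unfolding F_def .
  qed
  finally show ?thesis .
qed

text \<open>The ball in the j-th term has length 2^(j+1) D, so the term contributes 8 / 2^j maximal
  functions, and these add up to 16. The width \<open>D\<close> cancels, which is what later lets
  the bound leave the radial integral.\<close>

lemma poisson_ker_convolution_le_maximal_fun:
  assumes [measurable]: "W \<in> borel_measurable borel"
  shows "(\<integral>\<^sup>+y. W y * poisson_ker D (y - t) \<partial>lborel) \<le> 16 * maximal_fun W t"
proof (cases "D > 0")
  case True
  have "(\<integral>\<^sup>+y. W y * poisson_ker D (y - t) \<partial>lborel)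
      \<le> (\<integral>\<^sup>+y. (\<Sum>j. ennreal (4 * (1/4) ^ j / D) * (W y * indicator (ball t (2 ^ j * D)) y)) \<partial>lborel)"
  proof (rule nn_integral_mono)
    fix y
    have "W y * poisson_ker D (y - t) \<le> W y * (\<Sum>j. ennreal (4 * (1/4) ^ j / D) * indicator (ball t (2 ^ j * D)) y)"
      by (intro mult_left_mono poisson_ker_le_dyadic True) simp
    also have "\<dots> = (\<Sum>j. W y * (ennreal (4 * (1/4) ^ j / D) * indicator (ball t (2 ^ j * D)) y))"
      by simp
    finally show "W y * poisson_ker D (y - t) \<le> (\<Sum>j. ennreal (4 * (1/4) ^ j / D) * (W y * indicator (ball t (2 ^ j * D)) y))"
      by (simp only: mult.left_commute)
  qed
  also have "\<dots> = (\<Sum>j. ennreal (4 * (1/4) ^ j / D) * (\<integral>\<^sup>+y\<in>ball t (2 ^ j * D). W y \<partial>lborel))"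
    by (subst nn_integral_suminf) (auto simp: nn_integral_cmult intro!: suminf_cong, measurable)
  also have "\<dots> \<le> (\<Sum>j. ennreal (8 * (1/2) ^ j) * maximal_fun W t)"
  proof (intro suminf_le summableI)
    fix j
    have "ennreal (4 * (1/4) ^ j / D) * (\<integral>\<^sup>+y\<in>ball t (2 ^ j * D). W y \<partial>lborel)
        \<le> ennreal (4 * (1/4) ^ j / D) * (ennreal (2 * (2 ^ j * D)) * maximal_fun W t)"
      using True by (intro mult_left_mono maximal_fun_upper) auto
    also have "\<dots> = ennreal (4 * (1/4) ^ j / D * (2 * (2 ^ j * D))) * maximal_fun W t"
      using True by (subst ennreal_mult) (auto simp: mult.assoc)
    also have "4 * (1/4) ^ j / D * (2 * (2 ^ j * D)) = 8 * (1/2) ^ j"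
      using True by (simp add: field_simps flip: power_mult_distrib)
    finally show "ennreal (4 * (1/4) ^ j / D) * (\<integral>\<^sup>+y\<in>ball t (2 ^ j * D). W y \<partial>lborel)
        \<le> ennreal (8 * (1/2) ^ j) * maximal_fun W t" .
  qed
  also have "\<dots> = (\<Sum>j. ennreal (8 * (1/2) ^ j)) * maximal_fun W t"
    by simp
  also have "(\<Sum>j. ennreal (8 * (1/2) ^ j)) = ennreal 16"
    using sums_mult[OF geometric_sums[of "1/2::real"], of 8] by (intro suminf_ennreal_eq) auto
  finally show ?thesis by simp
next
  case False
  then have "poisson_ker D x = 0" for x
    by (auto simp: poisson_ker_def ennreal_eq_0_iff divide_le_0_iff)
  then show ?thesis by simp
qed

lemma maximal_fun_1_le: "maximal_fun (\<lambda>_. 1) t \<le> 1"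
  unfolding maximal_fun_def
  by (auto intro!: SUP_least simp: emeasure_lborel_ball_real simp flip: ennreal_mult)

text \<open>The exact mass for \<open>D > 0\<close> is pi; a crude bound comes for free from the
  constant function 1.\<close>

lemma poisson_ker_mass: "(\<integral>\<^sup>+y. poisson_ker D (y - t) \<partial>lborel) \<le> 16"
proof -
  have "(\<integral>\<^sup>+y. 1 * poisson_ker D (y - t) \<partial>lborel) \<le> 16 * maximal_fun (\<lambda>_. 1) t"
    by (rule poisson_ker_convolution_le_maximal_fun) simp
  also have "\<dots> \<le> 16 * 1"
    by (intro mult_left_mono maximal_fun_1_le) simp
  finally show ?thesis by simp
qed

section \<open>Truncation, duality and Jensen's inequality\<close>

lemma ennpowr_SUP:
  assumes "a > 0"
  shows "ennpowr (SUP i\<in>I. f i) a = (SUP i\<in>I. ennpowr (f i) a)"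
proof (rule antisym)
  have "f i \<le> ennpowr (SUP i\<in>I. ennpowr (f i) a) (1 / a)" if "i \<in> I" for i
  proof -
    have "ennpowr (ennpowr (f i) a) (1 / a) \<le> ennpowr (SUP i\<in>I. ennpowr (f i) a) (1 / a)"
      using assms that by (intro ennpowr_mono SUP_upper) auto
    then show ?thesis
      using assms by (simp add: ennpowr_ennpowr)
  qed
  then have "(SUP i\<in>I. f i) \<le> ennpowr (SUP i\<in>I. ennpowr (f i) a) (1 / a)"
    by (rule SUP_least)
  then have "ennpowr (SUP i\<in>I. f i) a \<le> ennpowr (ennpowr (SUP i\<in>I. ennpowr (f i) a) (1 / a)) a"
    using assms by (intro ennpowr_mono) auto
  then show "ennpowr (SUP i\<in>I. f i) a \<le> (SUP i\<in>I. ennpowr (f i) a)"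
    using assms by (simp add: ennpowr_ennpowr)
  show "(SUP i\<in>I. ennpowr (f i) a) \<le> ennpowr (SUP i\<in>I. f i) a"
    using assms by (intro SUP_least ennpowr_mono SUP_upper) auto
qed

text \<open>Cut off in height and in the angle at once: with a finite measure in the radius,
  truncated functions have finite mixed norms, and they still increase to the original
  function.\<close>

definition trunc :: "nat \<Rightarrow> real \<Rightarrow> ennreal \<Rightarrow> ennreal" where
  "trunc n t x = min x (of_nat n) * indicator {- real n..real n} t"

lemma measurable_trunc [measurable]:
  assumes [measurable]: "f \<in> borel_measurable M" "g \<in> borel_measurable M"
  shows "(\<lambda>x. trunc n (f x) (g x)) \<in> borel_measurable M"
  unfolding trunc_def by measurable

lemma trunc_le: "trunc n t x \<le> x"
  by (auto simp: trunc_def indicator_def)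

lemma trunc_le_of_nat: "trunc n t x \<le> of_nat n * indicator {- real n..real n} t"
  by (auto simp: trunc_def indicator_def)

lemma trunc_mono: "m \<le> n \<Longrightarrow> trunc m t x \<le> trunc n t x"
  unfolding trunc_def by (intro mult_mono min.mono) (auto simp: indicator_def)

lemma SUP_trunc: "(SUP n. trunc n t x) = x"
proof (rule antisym)
  show "x \<le> (SUP n. trunc n t x)"
  proof (rule dense_le)
    fix y assume y: "y < x"
    then have "y < top"
      by (metis less_top top_greatest order_less_le_trans)
    then obtain m where m: "y < of_nat m"
      using ennreal_Ex_less_of_nat by blast
    obtain k where k: "\<bar>t\<bar> \<le> real k"
      using real_arch_simple by blast
    have "y \<le> min x (of_nat (max m k))"
      using y m by (simp add: less_imp_le order.trans[OF less_imp_le[OF m]])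
    also have "\<dots> = trunc (max m k) t x"
      using k by (auto simp: trunc_def indicator_def)
    also have "\<dots> \<le> (SUP n. trunc n t x)"
      by (rule SUP_upper) simp
    finally show "y \<le> (SUP n. trunc n t x)" .
  qed
qed (auto intro!: SUP_least trunc_le)

lemma conjugate_exponent:
  fixes R :: real
  assumes "R > 1"
  shows "R / (R - 1) > 1" "1 / R + 1 / (R / (R - 1)) = 1" "1 / (R / (R - 1)) = 1 - 1 / R"
  using assms by (auto simp: field_simps)

text \<open>The converse of Hoelder's inequality. The test weight is the power \<open>R - 1\<close>
  of the truncated function; its dual norm is a power of the very quantity \<open>X n\<close> to be
  estimated, which is finite and can be absorbed. Monotone convergence removes the
  truncation.\<close>

lemma nn_integral_power_le_by_duality:
  fixes b :: "real \<Rightarrow> ennreal"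
  assumes [measurable]: "b \<in> borel_measurable borel" and R: "R > 1"
    and dual: "\<And>w. w \<in> borel_measurable borel \<Longrightarrow>
      (\<integral>\<^sup>+t. b t * w t \<partial>lborel) \<le> K * ennpowr (\<integral>\<^sup>+t. ennpowr (w t) (R / (R - 1)) \<partial>lborel) (1 - 1 / R)"
  shows "(\<integral>\<^sup>+t. ennpowr (b t) R \<partial>lborel) \<le> ennpowr K R"
proof -
  define X where "X n = (\<integral>\<^sup>+t. ennpowr (trunc n t (b t)) R \<partial>lborel)" for n
  have "X n \<le> ennpowr K R" for n
  proof (rule ennpowr_absorb)
    have "X n \<le> (\<integral>\<^sup>+t. ennpowr (of_nat n) R * indicator {- real n..real n} t \<partial>lborel)"
      unfolding X_def
    proof (rule nn_integral_mono)
      fix t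
      show "ennpowr (trunc n t (b t)) R \<le> ennpowr (of_nat n) R * indicator {- real n..real n} t"
        using ennpowr_mono[OF trunc_le_of_nat[of n t "b t"], of R] R
        by (auto simp: indicator_def split: if_splits)
    qed
    also have "\<dots> < top"
      by (simp add: nn_integral_cmult_indicator ennreal_mult_less_top of_nat_less_top)
    finally show "X n < top" .
    have "X n \<le> (\<integral>\<^sup>+t. b t * ennpowr (trunc n t (b t)) (R - 1) \<partial>lborel)"
      unfolding X_def
    proof (rule nn_integral_mono)
      fix t
      have "ennpowr (trunc n t (b t)) R = trunc n t (b t) * ennpowr (trunc n t (b t)) (R - 1)"
        using ennpowr_add[of "trunc n t (b t)" 1 "R - 1"] by simp
      then show "ennpowr (trunc n t (b t)) R \<le> b t * ennpowr (trunc n t (b t)) (R - 1)"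
        by (simp add: mult_right_mono trunc_le)
    qed
    also have "\<dots> \<le> K * ennpowr (\<integral>\<^sup>+t. ennpowr (ennpowr (trunc n t (b t)) (R - 1)) (R / (R - 1)) \<partial>lborel) (1 - 1 / R)"
      by (rule dual) measurable
    also have "\<dots> = K * ennpowr (X n) (1 - 1 / R)"
      using R by (simp add: X_def ennpowr_ennpowr)
    finally show "X n \<le> K * ennpowr (X n) (1 - 1 / R)" .
  qed (use R in auto)
  moreover have "(\<integral>\<^sup>+t. ennpowr (b t) R \<partial>lborel) = (SUP n. X n)"
  proof -
    have "(\<integral>\<^sup>+t. ennpowr (b t) R \<partial>lborel) = (\<integral>\<^sup>+t. (SUP n. ennpowr (trunc n t (b t)) R) \<partial>lborel)"
      using R ennpowr_SUP[of R "\<lambda>n. trunc n _ _" UNIV] by (simp add: SUP_trunc)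
    also have "\<dots> = (SUP n. X n)"
      unfolding X_def using R
      by (intro nn_integral_monotone_convergence_SUP)
         (auto simp: incseq_def le_fun_def intro!: ennpowr_mono trunc_mono)
    finally show ?thesis .
  qed
  ultimately show ?thesis
    by (auto intro!: SUP_least)
qed

text \<open>Jensen's inequality for a measure of total mass at most 16 instead of 1, hence the
  factor 16^(P-1). Hoelder's inequality is applied with the kernel split into its powers 1/P and
  1/P', only the first of which is attached to \<open>W\<close>.\<close>

lemma poisson_ker_convolution_Jensen:
  assumes [measurable]: "W \<in> borel_measurable borel" and P: "P \<ge> 1"
  shows "ennpowr (\<integral>\<^sup>+y. W y * poisson_ker D (y - t) \<partial>lborel) P
    \<le> ennpowr 16 (P - 1) * (\<integral>\<^sup>+y. ennpowr (W y) P * poisson_ker D (y - t) \<partial>lborel)"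
proof (cases "P = 1")
  case False
  with P have P1: "P > 1" by simp
  define P' where "P' = P / (P - 1)"
  note P' = conjugate_exponent[OF P1, folded P'_def]
  have "(\<integral>\<^sup>+y. W y * poisson_ker D (y - t) \<partial>lborel)
      = (\<integral>\<^sup>+y. (W y * ennpowr (poisson_ker D (y - t)) (1/P)) * ennpowr (poisson_ker D (y - t)) (1/P') \<partial>lborel)"
    by (simp only: mult.assoc ennpowr_add[symmetric] P'(2) ennpowr_one)
  also have "\<dots> \<le> ennpowr (\<integral>\<^sup>+y. ennpowr (W y * ennpowr (poisson_ker D (y - t)) (1/P)) P \<partial>lborel) (1/P)
      * ennpowr (\<integral>\<^sup>+y. ennpowr (ennpowr (poisson_ker D (y - t)) (1/P')) P' \<partial>lborel) (1/P')"
    by (intro nn_integral_Holder P1 P'(1,2)) measurable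
  also have "\<dots> = ennpowr (\<integral>\<^sup>+y. ennpowr (W y) P * poisson_ker D (y - t) \<partial>lborel) (1/P)
      * ennpowr (\<integral>\<^sup>+y. poisson_ker D (y - t) \<partial>lborel) (1/P')"
    using P1 P'(1) by (simp add: ennpowr_mult ennpowr_ennpowr)
  also have "\<dots> \<le> ennpowr (\<integral>\<^sup>+y. ennpowr (W y) P * poisson_ker D (y - t) \<partial>lborel) (1/P) * ennpowr 16 (1/P')"
    using P'(1) by (intro mult_left_mono ennpowr_mono poisson_ker_mass) auto
  finally have "ennpowr (\<integral>\<^sup>+y. W y * poisson_ker D (y - t) \<partial>lborel) P
      \<le> ennpowr (ennpowr (\<integral>\<^sup>+y. ennpowr (W y) P * poisson_ker D (y - t) \<partial>lborel) (1/P) * ennpowr 16 (1/P')) P"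
    using P1 by (intro ennpowr_mono) auto
  also have "\<dots> = ennpowr 16 (P - 1) * (\<integral>\<^sup>+y. ennpowr (W y) P * poisson_ker D (y - t) \<partial>lborel)"
  proof -
    have "1 / P' * P = P - 1"
      using P1 by (simp add: P'_def)
    then show ?thesis
      using P1 by (simp add: ennpowr_mult ennpowr_ennpowr mult.commute)
  qed
  finally show ?thesis .
qed (use ennpowr_ennreal[of 16 0] in simp)

subsection \<open>Averages on mixed norm spaces\<close>

text \<open>In the application \<open>M\<close> is Lebesgue measure on [0,1) and
  \<open>D r = 1 - r\<close>. Abstractly the radius is a mere parameter of the kernel; finiteness of
  \<open>M\<close> gives truncated functions finite mixed norms.\<close>

locale mixed_norm = finite_measure M for M :: "'a measure" +
  fixes D :: "'a \<Rightarrow> real"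
  assumes D_measurable [measurable]: "D \<in> borel_measurable M"
begin

definition avg :: "('a \<Rightarrow> real \<Rightarrow> ennreal) \<Rightarrow> 'a \<Rightarrow> real \<Rightarrow> ennreal" where
  "avg a r t = (\<integral>\<^sup>+y. a r y * poisson_ker (D r) (y - t) \<partial>lborel)"

sublocale prod: pair_sigma_finite M "lborel :: real measure" ..

lemma measurable_avg [measurable]:
  assumes [measurable]: "case_prod a \<in> borel_measurable (M \<Otimes>\<^sub>M borel)"
  shows "case_prod (avg a) \<in> borel_measurable (M \<Otimes>\<^sub>M borel)"
  unfolding avg_def by measurable

text \<open>For each fixed \<open>r\<close> the kernel is symmetric in the two angles, so Tonelli's
  theorem lets \<open>a\<close> and \<open>h\<close> trade places.\<close>

lemma avg_adjoint:
  assumes [measurable]: "case_prod a \<in> borel_measurable (M \<Otimes>\<^sub>M borel)"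
    "case_prod h \<in> borel_measurable (M \<Otimes>\<^sub>M borel)"
  shows "(\<integral>\<^sup>+t. \<integral>\<^sup>+r. avg a r t * h r t \<partial>M \<partial>lborel) = (\<integral>\<^sup>+t. \<integral>\<^sup>+r. a r t * avg h r t \<partial>M \<partial>lborel)"
proof -
  have swap: "(\<integral>\<^sup>+t. \<integral>\<^sup>+r. avg a r t * h r t \<partial>M \<partial>lborel)
      = (\<integral>\<^sup>+r. \<integral>\<^sup>+t. \<integral>\<^sup>+y. a r y * h r t * poisson_ker (D r) (y - t) \<partial>lborel \<partial>lborel \<partial>M)"
    if [measurable]: "case_prod a \<in> borel_measurable (M \<Otimes>\<^sub>M borel)"
      "case_prod h \<in> borel_measurable (M \<Otimes>\<^sub>M borel)" for a h
  proof -
    have "(\<integral>\<^sup>+t. \<integral>\<^sup>+r. avg a r t * h r t \<partial>M \<partial>lborel) = (\<integral>\<^sup>+r. \<integral>\<^sup>+t. avg a r t * h r t \<partial>lborel \<partial>M)"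
      by (rule prod.Fubini') measurable
    also have "\<dots> = (\<integral>\<^sup>+r. \<integral>\<^sup>+t. \<integral>\<^sup>+y. a r y * h r t * poisson_ker (D r) (y - t) \<partial>lborel \<partial>lborel \<partial>M)"
      unfolding avg_def
      by (intro nn_integral_cong, subst nn_integral_multc[symmetric])
         (measurable, auto simp: mult_ac intro!: nn_integral_cong)
    finally show ?thesis .
  qed
  have "(\<integral>\<^sup>+t. \<integral>\<^sup>+r. avg a r t * h r t \<partial>M \<partial>lborel)
      = (\<integral>\<^sup>+r. \<integral>\<^sup>+t. \<integral>\<^sup>+y. a r y * h r t * poisson_ker (D r) (y - t) \<partial>lborel \<partial>lborel \<partial>M)"
    by (rule swap) measurable
  also have "\<dots> = (\<integral>\<^sup>+r. \<integral>\<^sup>+y. \<integral>\<^sup>+t. a r y * h r t * poisson_ker (D r) (y - t) \<partial>lborel \<partial>lborel \<partial>M)"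
    by (intro nn_integral_cong lborel_pair.Fubini') measurable
  also have "\<dots> = (\<integral>\<^sup>+r. \<integral>\<^sup>+y. \<integral>\<^sup>+t. h r t * a r y * poisson_ker (D r) (t - y) \<partial>lborel \<partial>lborel \<partial>M)"
    by (intro nn_integral_cong) (simp only: mult.commute[of "h _ _"] poisson_ker_minus_commute)
  also have "\<dots> = (\<integral>\<^sup>+t. \<integral>\<^sup>+r. avg h r t * a r t \<partial>M \<partial>lborel)"
    by (rule swap[symmetric]) measurable
  finally show ?thesis
    by (simp only: mult.commute)
qed

text \<open>The weight depends on the angle alone. Once the average sits on it, the bound that is
  uniform in the width replaces it by \<open>16 * maximal_fun w t\<close>, which is constant in
  \<open>r\<close> and comes out of the integral over \<open>M\<close>.\<close>

lemma avg_weighted_le: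
  assumes [measurable]: "case_prod a \<in> borel_measurable (M \<Otimes>\<^sub>M borel)" "w \<in> borel_measurable borel"
  shows "(\<integral>\<^sup>+t. (\<integral>\<^sup>+r. avg a r t \<partial>M) * w t \<partial>lborel)
    \<le> 16 * (\<integral>\<^sup>+t. (\<integral>\<^sup>+r. a r t \<partial>M) * maximal_fun w t \<partial>lborel)"
proof -
  have "(\<integral>\<^sup>+t. (\<integral>\<^sup>+r. avg a r t \<partial>M) * w t \<partial>lborel) = (\<integral>\<^sup>+t. \<integral>\<^sup>+r. avg a r t * (\<lambda>_. w) r t \<partial>M \<partial>lborel)"
    by (intro nn_integral_cong nn_integral_multc[symmetric]) measurable
  also have "\<dots> = (\<integral>\<^sup>+t. \<integral>\<^sup>+r. a r t * avg (\<lambda>_. w) r t \<partial>M \<partial>lborel)"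
    by (rule avg_adjoint) measurable
  also have "\<dots> \<le> (\<integral>\<^sup>+t. \<integral>\<^sup>+r. a r t * (16 * maximal_fun w t) \<partial>M \<partial>lborel)"
    unfolding avg_def by (intro nn_integral_mono mult_left_mono poisson_ker_convolution_le_maximal_fun) auto
  also have "\<dots> = (\<integral>\<^sup>+t. 16 * ((\<integral>\<^sup>+r. a r t \<partial>M) * maximal_fun w t) \<partial>lborel)"
  proof (intro nn_integral_cong)
    fix t
    have "(\<integral>\<^sup>+r. a r t * (16 * maximal_fun w t) \<partial>M) = (\<integral>\<^sup>+r. a r t \<partial>M) * (16 * maximal_fun w t)"
      by (rule nn_integral_multc) measurable
    then show "(\<integral>\<^sup>+r. a r t * (16 * maximal_fun w t) \<partial>M) = 16 * ((\<integral>\<^sup>+r. a r t \<partial>M) * maximal_fun w t)"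
      by (simp only: mult_ac)
  qed
  also have "\<dots> = 16 * (\<integral>\<^sup>+t. (\<integral>\<^sup>+r. a r t \<partial>M) * maximal_fun w t \<partial>lborel)"
    by (rule nn_integral_cmult) measurable
  finally show ?thesis .
qed

text \<open>By duality only weighted integrals matter; there the maximal function falls on
  \<open>w\<close> and is bounded at the conjugate exponent. For \<open>R = 1\<close> that exponent
  is infinite, and the single weight 1 is enough.\<close>

lemma avg_bounded_L1:
  assumes R: "R \<ge> 1"
  obtains C :: real where "C > 0"
    "\<And>a. case_prod a \<in> borel_measurable (M \<Otimes>\<^sub>M borel) \<Longrightarrow>
      (\<integral>\<^sup>+t. ennpowr (\<integral>\<^sup>+r. avg a r t \<partial>M) R \<partial>lborel)
        \<le> ennreal C * (\<integral>\<^sup>+t. ennpowr (\<integral>\<^sup>+r. a r t \<partial>M) R \<partial>lborel)"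
proof (cases "R = 1")
  case True
  have "(\<integral>\<^sup>+t. ennpowr (\<integral>\<^sup>+r. avg a r t \<partial>M) R \<partial>lborel)
        \<le> ennreal 16 * (\<integral>\<^sup>+t. ennpowr (\<integral>\<^sup>+r. a r t \<partial>M) R \<partial>lborel)"
    if [measurable]: "case_prod a \<in> borel_measurable (M \<Otimes>\<^sub>M borel)" for a
  proof -
    have "(\<integral>\<^sup>+t. ennpowr (\<integral>\<^sup>+r. avg a r t \<partial>M) R \<partial>lborel) = (\<integral>\<^sup>+t. (\<integral>\<^sup>+r. avg a r t \<partial>M) * (\<lambda>_. 1) t \<partial>lborel)"
      by (simp add: True)
    also have "\<dots> \<le> 16 * (\<integral>\<^sup>+t. (\<integral>\<^sup>+r. a r t \<partial>M) * maximal_fun (\<lambda>_. 1) t \<partial>lborel)"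
      by (rule avg_weighted_le) measurable
    also have "\<dots> \<le> 16 * (\<integral>\<^sup>+t. (\<integral>\<^sup>+r. a r t \<partial>M) * 1 \<partial>lborel)"
      by (intro mult_left_mono nn_integral_mono maximal_fun_1_le) auto
    finally show ?thesis
      by (simp add: True)
  qed
  then show ?thesis
    by (intro that[of 16]) auto
next
  case False
  with R have R1: "R > 1" by simp
  define R' where "R' = R / (R - 1)"
  note R' = conjugate_exponent[OF R1, folded R'_def]
  define C0 where "C0 = 10 * R' * 2 powr (R' - 1) / (R' - 1)"
  have C0: "C0 > 0"
    using R'(1) by (simp add: C0_def)
  define C where "C = (16 * C0 powr (1 - 1/R)) powr R"
  have "(\<integral>\<^sup>+t. ennpowr (\<integral>\<^sup>+r. avg a r t \<partial>M) R \<partial>lborel)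
        \<le> ennreal C * (\<integral>\<^sup>+t. ennpowr (\<integral>\<^sup>+r. a r t \<partial>M) R \<partial>lborel)"
    if [measurable]: "case_prod a \<in> borel_measurable (M \<Otimes>\<^sub>M borel)" for a
  proof -
    have [measurable]: "(\<lambda>t. \<integral>\<^sup>+r. a r t \<partial>M) \<in> borel_measurable borel"
      by measurable
    define Y where "Y = (\<integral>\<^sup>+t. ennpowr (\<integral>\<^sup>+r. a r t \<partial>M) R \<partial>lborel)"
    \<comment> \<open>16 comes from the weighted bound and \<open>C0\<close> from the maximal
      theorem on the dual side. Raising to the power \<open>R\<close> turns
      \<open>ennpowr Y (1/R)\<close> back into \<open>Y\<close>.\<close>
    define K where "K = 16 * (ennpowr Y (1/R) * ennreal (C0 powr (1 - 1/R)))"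
    have "(\<integral>\<^sup>+t. ennpowr (\<integral>\<^sup>+r. avg a r t \<partial>M) R \<partial>lborel) \<le> ennpowr K R"
    proof (rule nn_integral_power_le_by_duality)
      fix w :: "real \<Rightarrow> ennreal"
      assume [measurable]: "w \<in> borel_measurable borel"
      have "(\<integral>\<^sup>+t. (\<integral>\<^sup>+r. avg a r t \<partial>M) * w t \<partial>lborel)
          \<le> 16 * (\<integral>\<^sup>+t. (\<integral>\<^sup>+r. a r t \<partial>M) * maximal_fun w t \<partial>lborel)"
        by (rule avg_weighted_le) measurable
      also have "\<dots> \<le> 16 * (ennpowr Y (1/R) * ennpowr (\<integral>\<^sup>+t. ennpowr (maximal_fun w t) R' \<partial>lborel) (1/R'))"
        unfolding Y_def by (intro mult_left_mono nn_integral_Holder R1 R'(1,2)) auto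
      also have "\<dots> \<le> 16 * (ennpowr Y (1/R) * ennpowr (ennreal C0 * (\<integral>\<^sup>+t. ennpowr (w t) R' \<partial>lborel)) (1/R'))"
        unfolding C0_def using R'(1)
        by (intro mult_left_mono ennpowr_mono maximal_fun_strong_type) auto
      also have "\<dots> = K * ennpowr (\<integral>\<^sup>+t. ennpowr (w t) R' \<partial>lborel) (1 - 1/R)"
        using C0 by (simp add: K_def ennpowr_mult ennpowr_ennreal R'(3) mult.assoc)
      finally show "(\<integral>\<^sup>+t. (\<integral>\<^sup>+r. avg a r t \<partial>M) * w t \<partial>lborel)
          \<le> K * ennpowr (\<integral>\<^sup>+t. ennpowr (w t) (R / (R - 1)) \<partial>lborel) (1 - 1 / R)"
        by (simp add: R'_def)
    qed (measurable, use R1 in simp)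
    also have "ennpowr K R = ennreal C * Y"
    proof -
      have "K = ennreal (16 * C0 powr (1 - 1/R)) * ennpowr Y (1/R)"
        by (simp add: K_def ennreal_mult mult_ac)
      then show ?thesis
        using R1 by (simp add: ennpowr_mult ennpowr_ennpowr C_def ennpowr_ennreal)
    qed
    finally show ?thesis
      by (simp add: Y_def)
  qed
  moreover have "C > 0"
    using C0 by (simp add: C_def)
  ultimately show ?thesis
    using that by blast
qed

text \<open>The \<open>Q\<close>-th power of the norm of L^Q(L^P), with the outer root omitted. The
  angle runs over the whole line, since the functions are cut off beforehand.\<close>

definition mixed :: "real \<Rightarrow> real \<Rightarrow> ('a \<Rightarrow> real \<Rightarrow> ennreal) \<Rightarrow> ennreal" where
  "mixed P Q a = (\<integral>\<^sup>+t. ennpowr (\<integral>\<^sup>+r. ennpowr (a r t) P \<partial>M) (Q / P) \<partial>lborel)"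

text \<open>Jensen's inequality in the angle bounds the P-th power of an average by an average of
  P-th powers. This reduces the claim to inner exponent 1 and outer exponent \<open>Q / P\<close>,
  which must be at least 1.\<close>

lemma avg_bounded_increasing_exponents:
  assumes PQ: "1 \<le> P" "P \<le> Q"
  obtains C :: real where "C > 0"
    "\<And>a. case_prod a \<in> borel_measurable (M \<Otimes>\<^sub>M borel) \<Longrightarrow> mixed P Q (avg a) \<le> ennreal C * mixed P Q a"
proof -
  have R: "Q / P \<ge> 1"
    using PQ by simp
  obtain C :: real where C: "C > 0"
    "\<And>a. case_prod a \<in> borel_measurable (M \<Otimes>\<^sub>M borel) \<Longrightarrow>
      (\<integral>\<^sup>+t. ennpowr (\<integral>\<^sup>+r. avg a r t \<partial>M) (Q / P) \<partial>lborel)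
        \<le> ennreal C * (\<integral>\<^sup>+t. ennpowr (\<integral>\<^sup>+r. a r t \<partial>M) (Q / P) \<partial>lborel)"
    by (rule avg_bounded_L1[OF R]) blast
  define B where "B = (16 powr (P - 1)) powr (Q / P)"
  have "mixed P Q (avg a) \<le> ennreal (B * C) * mixed P Q a"
    if [measurable]: "case_prod a \<in> borel_measurable (M \<Otimes>\<^sub>M borel)" for a
  proof -
    define A where "A r t = ennpowr (a r t) P" for r t
    have [measurable]: "case_prod A \<in> borel_measurable (M \<Otimes>\<^sub>M borel)"
      unfolding A_def by measurable
    have "mixed P Q (avg a) \<le> (\<integral>\<^sup>+t. ennpowr (\<integral>\<^sup>+r. ennreal (16 powr (P - 1)) * avg A r t \<partial>M) (Q / P) \<partial>lborel)"
      unfolding mixed_def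
    proof (intro nn_integral_mono ennpowr_mono)
      fix r t assume "r \<in> space M"
      then have [measurable]: "a r \<in> borel_measurable borel"
        by measurable
      show "ennpowr (avg a r t) P \<le> ennreal (16 powr (P - 1)) * avg A r t"
        using poisson_ker_convolution_Jensen[of "a r" P "D r" t] PQ ennpowr_ennreal[of 16 "P - 1"]
        by (simp add: avg_def A_def)
    qed (use PQ in auto)
    also have "\<dots> = (\<integral>\<^sup>+t. ennreal B * ennpowr (\<integral>\<^sup>+r. avg A r t \<partial>M) (Q / P) \<partial>lborel)"
      by (intro nn_integral_cong, subst nn_integral_cmult)
         (measurable, auto simp: ennpowr_mult ennpowr_ennreal B_def)
    also have "\<dots> = ennreal B * (\<integral>\<^sup>+t. ennpowr (\<integral>\<^sup>+r. avg A r t \<partial>M) (Q / P) \<partial>lborel)"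
      by (rule nn_integral_cmult) measurable
    also have "\<dots> \<le> ennreal B * (ennreal C * (\<integral>\<^sup>+t. ennpowr (\<integral>\<^sup>+r. A r t \<partial>M) (Q / P) \<partial>lborel))"
      by (intro mult_left_mono C(2)) auto
    also have "\<dots> = ennreal (B * C) * mixed P Q a"
      using C(1) by (simp add: mixed_def A_def B_def ennreal_mult mult.assoc)
    finally show ?thesis .
  qed
  moreover have "B * C > 0"
    using C(1) by (simp add: B_def)
  ultimately show ?thesis
    using that by blast
qed

lemma mixed_trunc_less_top:
  assumes P: "0 < P" and Q: "0 < Q"
  shows "mixed P Q (\<lambda>r t. trunc n t (H r t)) < top"
proof -
  define m where "m = ennpowr (of_nat n) P * emeasure M (space M)"
  have "mixed P Q (\<lambda>r t. trunc n t (H r t)) \<le> (\<integral>\<^sup>+t. ennpowr m (Q / P) * indicator {- real n..real n} t \<partial>lborel)"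
    unfolding mixed_def
  proof (rule nn_integral_mono)
    fix t
    have "(\<integral>\<^sup>+r. ennpowr (trunc n t (H r t)) P \<partial>M) \<le> (\<integral>\<^sup>+r. ennpowr (of_nat n) P * indicator {- real n..real n} t \<partial>M)"
    proof (rule nn_integral_mono)
      fix r
      show "ennpowr (trunc n t (H r t)) P \<le> ennpowr (of_nat n) P * indicator {- real n..real n} t"
        using ennpowr_mono[OF trunc_le_of_nat[of n t "H r t"], of P] P
        by (auto simp: indicator_def split: if_splits)
    qed
    also have "\<dots> = m * indicator {- real n..real n} t"
      by (simp add: m_def mult_ac)
    finally have "(\<integral>\<^sup>+r. ennpowr (trunc n t (H r t)) P \<partial>M) \<le> m * indicator {- real n..real n} t" .
    then have "ennpowr (\<integral>\<^sup>+r. ennpowr (trunc n t (H r t)) P \<partial>M) (Q / P) \<le> ennpowr (m * indicator {- real n..real n} t) (Q / P)"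
      using P Q by (intro ennpowr_mono) auto
    then show "ennpowr (\<integral>\<^sup>+r. ennpowr (trunc n t (H r t)) P \<partial>M) (Q / P) \<le> ennpowr m (Q / P) * indicator {- real n..real n} t"
      by (auto simp: indicator_def split: if_splits)
  qed
  also have "\<dots> < top"
  proof -
    have "m < top"
      by (simp add: m_def ennreal_mult_less_top of_nat_less_top less_top[THEN iffD1, OF emeasure_finite])
    then show ?thesis
      by (simp add: nn_integral_cmult_indicator ennreal_mult_less_top)
  qed
  finally show ?thesis .
qed

lemma SUP_mixed_trunc:
  assumes P: "0 < P" and Q: "0 < Q" and [measurable]: "case_prod H \<in> borel_measurable (M \<Otimes>\<^sub>M borel)"
  shows "(SUP n. mixed P Q (\<lambda>r t. trunc n t (H r t))) = mixed P Q H"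
proof -
  have pow: "ennpowr (H r t) P = (SUP n. ennpowr (trunc n t (H r t)) P)" for r t
    using ennpowr_SUP[OF P, of "\<lambda>n. trunc n t (H r t)" UNIV] by (simp add: SUP_trunc)
  have "mixed P Q H = (\<integral>\<^sup>+t. ennpowr (SUP n. \<integral>\<^sup>+r. ennpowr (trunc n t (H r t)) P \<partial>M) (Q / P) \<partial>lborel)"
    unfolding mixed_def pow using P
    by (subst nn_integral_monotone_convergence_SUP)
       (auto simp: incseq_def le_fun_def intro!: ennpowr_mono trunc_mono)
  also have "\<dots> = (\<integral>\<^sup>+t. (SUP n. ennpowr (\<integral>\<^sup>+r. ennpowr (trunc n t (H r t)) P \<partial>M) (Q / P)) \<partial>lborel)"
    using P Q by (simp add: ennpowr_SUP)
  also have "\<dots> = (SUP n. mixed P Q (\<lambda>r t. trunc n t (H r t)))"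
    unfolding mixed_def using P Q
    by (intro nn_integral_monotone_convergence_SUP)
       (auto simp: incseq_def le_fun_def intro!: ennpowr_mono trunc_mono nn_integral_mono)
  finally show ?thesis by simp
qed

text \<open>Duality: for \<open>Q < P\<close> the conjugate exponents satisfy \<open>P' < Q'\<close>, and the averaging operator is
  its own adjoint.\<close>

lemma avg_bounded_decreasing_exponents:
  assumes PQ: "1 < Q" "Q < P"
  obtains C :: real where "C > 0"
    "\<And>a. case_prod a \<in> borel_measurable (M \<Otimes>\<^sub>M borel) \<Longrightarrow> mixed P Q (avg a) \<le> ennreal C * mixed P Q a"
proof -
  have P1: "1 < P" using PQ by simp
  define P' where "P' = P / (P - 1)"
  note P' = conjugate_exponent[OF P1, folded P'_def]
  define Q' where "Q' = Q / (Q - 1)"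
  note Q' = conjugate_exponent[OF PQ(1), folded Q'_def]
  have "1 \<le> P'" "P' \<le> Q'"
    using PQ P1 P'(1) by (auto simp: P'_def Q'_def field_simps)
  then obtain C0 :: real where C0: "C0 > 0"
    "\<And>a. case_prod a \<in> borel_measurable (M \<Otimes>\<^sub>M borel) \<Longrightarrow> mixed P' Q' (avg a) \<le> ennreal C0 * mixed P' Q' a"
    by (rule avg_bounded_increasing_exponents) blast
  define C where "C = (C0 powr (1/Q')) powr Q"
  have "mixed P Q (avg a) \<le> ennreal C * mixed P Q a"
    if [measurable]: "case_prod a \<in> borel_measurable (M \<Otimes>\<^sub>M borel)" for a
  proof -
    define X where "X n = mixed P Q (\<lambda>r t. trunc n t (avg a r t))" for n
    define K where "K = ennpowr (mixed P Q a) (1/Q) * ennreal (C0 powr (1/Q'))"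
    have "X n \<le> ennpowr K Q" for n
    proof (rule ennpowr_absorb)
      show "0 < Q" using PQ by simp
      show "X n < top"
        unfolding X_def using PQ by (intro mixed_trunc_less_top) auto
      define H where "H r t = trunc n t (avg a r t)" for r t
      define \<phi> where "\<phi> t = (\<integral>\<^sup>+r. ennpowr (H r t) P \<partial>M)" for t
      \<comment> \<open>The extremal function for the pairing of L^Q(L^P) with its dual: paired with
        \<open>H\<close> it gives \<open>ennpowr (\<phi> t) (Q / P)\<close> at each angle. The
        exponent of \<open>\<phi>\<close> is negative; where \<open>\<phi>\<close> is 0 the
        conventions make \<open>h\<close> vanish too.\<close>
      define h where "h r t = ennpowr (H r t) (P - 1) * ennpowr (\<phi> t) ((Q - P) / P)" for r t
      have H [measurable]: "case_prod H \<in> borel_measurable (M \<Otimes>\<^sub>M borel)"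
        unfolding H_def by measurable
      have \<phi> [measurable]: "\<phi> \<in> borel_measurable borel"
        unfolding \<phi>_def by measurable
      have h [measurable]: "case_prod h \<in> borel_measurable (M \<Otimes>\<^sub>M borel)"
        unfolding h_def by measurable
      have Xn: "X n = (\<integral>\<^sup>+t. ennpowr (\<phi> t) (Q / P) \<partial>lborel)"
        by (simp add: X_def mixed_def \<phi>_def H_def)
      have \<phi>_split: "ennpowr (\<phi> t) (Q / P) = (\<integral>\<^sup>+r. H r t * h r t \<partial>M)" for t
      proof -
        have "Q / P = 1 + (Q - P) / P"
          using P1 by (simp add: field_simps)
        then have "ennpowr (\<phi> t) (Q / P) = \<phi> t * ennpowr (\<phi> t) ((Q - P) / P)"
          using ennpowr_add[of "\<phi> t" 1 "(Q - P) / P"] by simp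
        also have "\<dots> = (\<integral>\<^sup>+r. ennpowr (H r t) P * ennpowr (\<phi> t) ((Q - P) / P) \<partial>M)"
          unfolding \<phi>_def by (rule nn_integral_multc[symmetric]) measurable
        also have "\<dots> = (\<integral>\<^sup>+r. H r t * h r t \<partial>M)"
        proof (rule nn_integral_cong)
          fix r
          show "ennpowr (H r t) P * ennpowr (\<phi> t) ((Q - P) / P) = H r t * h r t"
            using ennpowr_add[of "H r t" 1 "P - 1"] by (simp add: h_def mult.assoc)
        qed
        finally show ?thesis .
      qed
      \<comment> \<open>The dual norm of \<open>h\<close> is expressed by \<open>X n\<close> itself,
        so \<open>X n\<close> reappears on the right with exponent 1/Q' = 1 - 1/Q and can be
        absorbed.\<close>
      have h_norm: "mixed P' Q' h = X n"
        unfolding mixed_def Xn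
      proof (rule nn_integral_cong)
        fix t
        have "(\<integral>\<^sup>+r. ennpowr (h r t) P' \<partial>M) = (\<integral>\<^sup>+r. ennpowr (H r t) P * ennpowr (\<phi> t) ((Q - P) / P * P') \<partial>M)"
          using P1 by (simp add: h_def ennpowr_mult ennpowr_ennpowr P'_def)
        also have "\<dots> = \<phi> t * ennpowr (\<phi> t) ((Q - P) / P * P')"
          unfolding \<phi>_def by (rule nn_integral_multc) measurable
        also have "\<dots> = ennpowr (\<phi> t) (1 + (Q - P) / P * P')"
          by (simp add: ennpowr_add)
        finally have "ennpowr (\<integral>\<^sup>+r. ennpowr (h r t) P' \<partial>M) (Q' / P')
            = ennpowr (\<phi> t) ((1 + (Q - P) / P * P') * (Q' / P'))"
          by (simp add: ennpowr_ennpowr)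
        also have "(1 + (Q - P) / P * P') * (Q' / P') = Q / P"
        proof -
          have "(1 + (Q - P) / P * P') * (Q' / P') = Q' * (1 / P' + (Q - P) / P)"
            using P'(1) by (simp add: field_simps)
          also have "1 / P' + (Q - P) / P = (Q - 1) / P"
            using P1 unfolding P'(3) by (simp add: field_simps)
          finally show ?thesis
            using PQ by (simp add: Q'_def)
        qed
        finally show "ennpowr (\<integral>\<^sup>+r. ennpowr (h r t) P' \<partial>M) (Q' / P') = ennpowr (\<phi> t) (Q / P)" .
      qed
      have "X n = (\<integral>\<^sup>+t. \<integral>\<^sup>+r. H r t * h r t \<partial>M \<partial>lborel)"
        unfolding Xn \<phi>_split ..
      \<comment> \<open>The factor \<open>H\<close> is replaced by the full average, so that the
        adjoint can be taken; the truncation survives inside \<open>h\<close>.\<close>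
      also have "\<dots> \<le> (\<integral>\<^sup>+t. \<integral>\<^sup>+r. avg a r t * h r t \<partial>M \<partial>lborel)"
        unfolding H_def by (intro nn_integral_mono mult_right_mono trunc_le) simp
      also have "\<dots> = (\<integral>\<^sup>+t. \<integral>\<^sup>+r. a r t * avg h r t \<partial>M \<partial>lborel)"
        by (rule avg_adjoint) measurable
      also have "\<dots> \<le> (\<integral>\<^sup>+t. ennpowr (\<integral>\<^sup>+r. ennpowr (a r t) P \<partial>M) (1/P)
          * ennpowr (\<integral>\<^sup>+r. ennpowr (avg h r t) P' \<partial>M) (1/P') \<partial>lborel)"
        by (intro nn_integral_mono nn_integral_Holder P1 P'(1,2)) measurable
      also have "\<dots> \<le> ennpowr (\<integral>\<^sup>+t. ennpowr (ennpowr (\<integral>\<^sup>+r. ennpowr (a r t) P \<partial>M) (1/P)) Q \<partial>lborel) (1/Q)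
          * ennpowr (\<integral>\<^sup>+t. ennpowr (ennpowr (\<integral>\<^sup>+r. ennpowr (avg h r t) P' \<partial>M) (1/P')) Q' \<partial>lborel) (1/Q')"
        by (intro nn_integral_Holder PQ(1) Q'(1,2)) measurable
      also have "\<dots> = ennpowr (mixed P Q a) (1/Q) * ennpowr (mixed P' Q' (avg h)) (1/Q')"
        by (simp add: ennpowr_ennpowr mixed_def)
      also have "\<dots> \<le> ennpowr (mixed P Q a) (1/Q) * ennpowr (ennreal C0 * mixed P' Q' h) (1/Q')"
        using Q'(1) by (intro mult_left_mono ennpowr_mono C0(2)) auto
      also have "\<dots> = K * ennpowr (X n) (1 - 1 / Q)"
        using C0(1) by (simp add: h_norm K_def ennpowr_mult ennpowr_ennreal mult.assoc Q'(3))
      finally show "X n \<le> K * ennpowr (X n) (1 - 1 / Q)" .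
    qed
    then have "(SUP n. X n) \<le> ennpowr K Q"
      by (intro SUP_least)
    also have "ennpowr K Q = ennreal C * mixed P Q a"
      using PQ by (simp add: K_def ennpowr_mult ennpowr_ennpowr ennpowr_ennreal C_def mult.commute)
    finally show ?thesis
      unfolding X_def using PQ by (subst (asm) SUP_mixed_trunc) auto
  qed
  moreover have "C > 0"
    using C0(1) by (simp add: C_def)
  ultimately show ?thesis
    using that by blast
qed

end

subsection \<open>Cauchy estimates\<close>

text \<open>The parametrisation of the circle contributes a factor \<sigma> \<le> 1, which is
  dropped.\<close>

lemma norm_contour_integral_circlepath_le_nn:
  assumes I: "(h has_contour_integral I) (circlepath 0 \<sigma>)" and \<sigma>: "0 < \<sigma>" "\<sigma> \<le> 1"
    and h: "continuous_on (sphere 0 \<sigma>) h"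
  shows "ennreal (cmod I) \<le> (\<integral>\<^sup>+\<theta>\<in>{0..2 * pi}. ennreal (cmod (h (of_real \<sigma> * cis \<theta>))) \<partial>lborel)"
proof -
  define g where "g = (\<lambda>t. h (0 + of_real \<sigma> * cis t) * of_real \<sigma> * \<i> * cis t)"
  have g_int: "(g has_integral I) {0..2 * pi}"
    using I unfolding circlepath_def g_def by (subst (asm) has_contour_integral_part_circlepath_iff) auto
  have cont: "continuous_on UNIV (\<lambda>t. h (of_real \<sigma> * cis t))"
    using \<sigma> by (intro continuous_on_compose2[OF h] continuous_intros) (auto simp: norm_mult)
  have cont_norm: "continuous_on {0..2 * pi} (\<lambda>t. cmod (h (of_real \<sigma> * cis t)))"
    by (intro continuous_intros continuous_on_subset[OF cont]) auto
  have norm_int: "((\<lambda>t. cmod (h (of_real \<sigma> * cis t))) has_integral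
      integral {0..2 * pi} (\<lambda>t. cmod (h (of_real \<sigma> * cis t)))) {0..2 * pi}"
    by (intro integrable_integral integrable_continuous_interval cont_norm)
  have "cmod I \<le> integral {0..2 * pi} (\<lambda>t. cmod (h (of_real \<sigma> * cis t)))"
  proof -
    have "cmod (integral {0..2 * pi} g) \<le> integral {0..2 * pi} (\<lambda>t. cmod (h (of_real \<sigma> * cis t)))"
    proof (rule integral_norm_bound_integral)
      show "g integrable_on {0..2 * pi}"
        using g_int by blast
      show "(\<lambda>t. cmod (h (of_real \<sigma> * cis t))) integrable_on {0..2 * pi}"
        using norm_int by blast
      show "cmod (g t) \<le> cmod (h (of_real \<sigma> * cis t))" for t
        using \<sigma> by (simp add: g_def norm_mult mult_left_le)
    qed
    then show ?thesis
      using g_int by (simp add: integral_unique)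
  qed
  then have "ennreal (cmod I) \<le> ennreal (integral {0..2 * pi} (\<lambda>t. cmod (h (of_real \<sigma> * cis t))))"
    by (rule ennreal_leI)
  also have "\<dots> = (\<integral>\<^sup>+\<theta>. indicator {0..2 * pi} \<theta> * cmod (h (of_real \<sigma> * cis \<theta>)) \<partial>lborel)"
    by (rule nn_integral_has_integral_lebesgue[symmetric, OF _ norm_int]) simp
  also have "\<dots> = (\<integral>\<^sup>+\<theta>\<in>{0..2 * pi}. ennreal (cmod (h (of_real \<sigma> * cis \<theta>))) \<partial>lborel)"
    by (intro nn_integral_cong) (auto simp: indicator_def)
  finally show ?thesis .
qed

lemma nn_integral_shift_interval:
  fixes u :: "real \<Rightarrow> ennreal"
  assumes [measurable]: "u \<in> borel_measurable borel"
  shows "(\<integral>\<^sup>+t\<in>{b..c}. u (t + a) \<partial>lborel) = (\<integral>\<^sup>+t\<in>{b + a..c + a}. u t \<partial>lborel)"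
proof -
  have "(\<integral>\<^sup>+t\<in>{b + a..c + a}. u t \<partial>lborel) = (\<integral>\<^sup>+t. u (a + 1 * t) * indicator {b + a..c + a} (a + 1 * t) \<partial>lborel)"
    by (subst nn_integral_real_affine[where c = 1 and t = a]) auto
  also have "\<dots> = (\<integral>\<^sup>+t\<in>{b..c}. u (t + a) \<partial>lborel)"
    by (intro nn_integral_cong) (auto simp: indicator_def add.commute)
  finally show ?thesis by simp
qed

text \<open>Rotation by \<open>cis a\<close> moves the starting angle of Cauchy's formula to
  \<open>a\<close>. Later \<open>a = t - pi\<close> puts the angle \<open>t\<close> in the middle,
  so that |\<theta> - t| \<le> pi. The factor 1 / (2 pi) is estimated by 1.\<close>

lemma Cauchy_bounds_circle:
  assumes F: "F holomorphic_on ball 0 1" and z: "cmod z < \<sigma>" and \<sigma>: "\<sigma> < 1"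
  shows "ennreal (cmod (F z)) \<le>
      (\<integral>\<^sup>+\<theta>\<in>{a..a + 2 * pi}. ennreal (cmod (F (of_real \<sigma> * cis \<theta>)) / cmod (of_real \<sigma> * cis \<theta> - z)) \<partial>lborel)"
    and "ennreal (cmod (deriv F z)) \<le>
      (\<integral>\<^sup>+\<theta>\<in>{a..a + 2 * pi}. ennreal (cmod (F (of_real \<sigma> * cis \<theta>)) / (cmod (of_real \<sigma> * cis \<theta> - z))\<^sup>2) \<partial>lborel)"
proof -
  define G where "G w = F (cis a * w)" for w
  define z' where "z' = cis (- a) * z"
  have z': "cis a * z' = z" "cmod z' < \<sigma>"
    using z by (auto simp: z'_def norm_mult cis_mult mult.assoc[symmetric])
  have \<sigma>0: "\<sigma> > 0"
    using z by (meson le_less_trans norm_ge_zero)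
  have G: "G holomorphic_on ball 0 1"
    unfolding G_def by (intro holomorphic_on_compose_gen[OF _ F, unfolded o_def] holomorphic_intros)
      (auto simp: norm_mult)
  have cont: "continuous_on (cball 0 \<sigma>) G"
    by (intro holomorphic_on_imp_continuous_on holomorphic_on_subset[OF G]) (use \<sigma> in auto)
  have hol: "G holomorphic_on ball 0 \<sigma>"
    by (rule holomorphic_on_subset[OF G]) (use \<sigma> in auto)
  have ne: "u \<noteq> z'" if "u \<in> sphere 0 \<sigma>" for u
    using that z'(2) by auto
  have contF: "continuous_on UNIV (\<lambda>t. F (of_real \<sigma> * cis t))"
    by (rule continuous_on_compose2[OF holomorphic_on_imp_continuous_on[OF F]])
       (use \<sigma>0 \<sigma> in \<open>auto simp: norm_mult intro!: continuous_intros\<close>)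
  have pos: "cmod (of_real \<sigma> * cis t - z) \<noteq> 0" for t
    using z \<sigma>0 by (auto simp: norm_mult)
  have rot: "cmod (of_real \<sigma> * cis t - z') = cmod (of_real \<sigma> * cis (t + a) - z)" for t
  proof -
    have "cmod (of_real \<sigma> * cis t - z') = cmod (cis a * (of_real \<sigma> * cis t - z'))"
      by (simp add: norm_mult)
    also have "cis a * (of_real \<sigma> * cis t - z') = of_real \<sigma> * cis (t + a) - z"
    proof -
      have "cis a * (of_real \<sigma> * cis t - z') = of_real \<sigma> * (cis t * cis a) - cis a * z'"
        by (simp only: right_diff_distrib mult_ac)
      then show ?thesis
        by (simp only: z'(1) cis_mult)
    qed
    finally show ?thesis .
  qed
  have Gc: "G (of_real \<sigma> * cis t) = F (of_real \<sigma> * cis (t + a))" for t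
    by (simp add: G_def cis_mult[symmetric] mult_ac)
  have derivG: "deriv G z' = cis a * deriv F z"
  proof -
    have "(F has_field_derivative deriv F z) (at (cis a * z'))"
      using holomorphic_derivI[OF F, of z] z' z \<sigma> by simp
    then have "(G has_field_derivative deriv F z * cis a) (at z')"
      unfolding G_def by (rule DERIV_chain2) (auto intro!: derivative_eq_intros)
    then show ?thesis
      by (simp add: DERIV_imp_deriv mult.commute)
  qed
  have pi1: "x \<le> 2 * pi * x" if "x \<ge> 0" for x :: real
    using that pi_ge_two mult_right_mono[of 1 "2 * pi" x] by simp
  have "ennreal (cmod (F z)) \<le> ennreal (cmod (2 * of_real pi * \<i> * G z'))"
    using pi1 by (auto simp: norm_mult G_def z'(1) intro!: ennreal_leI)
  also have "\<dots> \<le> (\<integral>\<^sup>+\<theta>\<in>{0..2 * pi}. ennreal (cmod (G (of_real \<sigma> * cis \<theta>) / (of_real \<sigma> * cis \<theta> - z'))) \<partial>lborel)"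
    by (rule norm_contour_integral_circlepath_le_nn[OF Cauchy_integral_circlepath[OF cont hol]])
       (use z'(2) \<sigma>0 \<sigma> ne in \<open>auto intro!: continuous_intros continuous_on_subset[OF cont]\<close>)
  also have "\<dots> = (\<integral>\<^sup>+\<theta>\<in>{0..2 * pi}. (\<lambda>\<theta>. ennreal (cmod (F (of_real \<sigma> * cis \<theta>)) / cmod (of_real \<sigma> * cis \<theta> - z))) (\<theta> + a) \<partial>lborel)"
    by (simp only: norm_divide rot Gc)
  also have "\<dots> = (\<integral>\<^sup>+\<theta>\<in>{0 + a..2 * pi + a}. ennreal (cmod (F (of_real \<sigma> * cis \<theta>)) / cmod (of_real \<sigma> * cis \<theta> - z)) \<partial>lborel)"
    by (rule nn_integral_shift_interval)
       (use pos in \<open>auto intro!: borel_measurable_continuous_onI continuous_intros contF measurable_compose[OF _ measurable_ennreal]\<close>)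
  finally show "ennreal (cmod (F z)) \<le>
      (\<integral>\<^sup>+\<theta>\<in>{a..a + 2 * pi}. ennreal (cmod (F (of_real \<sigma> * cis \<theta>)) / cmod (of_real \<sigma> * cis \<theta> - z)) \<partial>lborel)"
    by (simp add: add.commute)
  have "((\<lambda>u. G u / (u - z') ^ Suc 1) has_contour_integral (2 * pi * \<i>) / fact 1 * (deriv ^^ 1) G z') (circlepath 0 \<sigma>)"
    by (rule Cauchy_has_contour_integral_higher_derivative_circlepath[OF cont hol]) (use z'(2) in simp)
  then have 2: "((\<lambda>u. G u / (u - z')\<^sup>2) has_contour_integral 2 * of_real pi * \<i> * deriv G z') (circlepath 0 \<sigma>)"
    by (simp add: numeral_2_eq_2)
  have "ennreal (cmod (deriv F z)) \<le> ennreal (cmod (2 * of_real pi * \<i> * deriv G z'))"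
    using pi1 by (auto simp: norm_mult derivG intro!: ennreal_leI)
  also have "\<dots> \<le> (\<integral>\<^sup>+\<theta>\<in>{0..2 * pi}. ennreal (cmod (G (of_real \<sigma> * cis \<theta>) / (of_real \<sigma> * cis \<theta> - z')\<^sup>2)) \<partial>lborel)"
    by (rule norm_contour_integral_circlepath_le_nn[OF 2])
       (use z'(2) \<sigma>0 \<sigma> ne in \<open>auto intro!: continuous_intros continuous_on_subset[OF cont]\<close>)
  also have "\<dots> = (\<integral>\<^sup>+\<theta>\<in>{0..2 * pi}. (\<lambda>\<theta>. ennreal (cmod (F (of_real \<sigma> * cis \<theta>)) / (cmod (of_real \<sigma> * cis \<theta> - z))\<^sup>2)) (\<theta> + a) \<partial>lborel)"
    by (simp only: norm_divide norm_power rot Gc)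
  also have "\<dots> = (\<integral>\<^sup>+\<theta>\<in>{0 + a..2 * pi + a}. ennreal (cmod (F (of_real \<sigma> * cis \<theta>)) / (cmod (of_real \<sigma> * cis \<theta> - z))\<^sup>2) \<partial>lborel)"
    by (rule nn_integral_shift_interval)
       (use pos in \<open>auto intro!: borel_measurable_continuous_onI continuous_intros contF measurable_compose[OF _ measurable_ennreal]\<close>)
  finally show "ennreal (cmod (deriv F z)) \<le>
      (\<integral>\<^sup>+\<theta>\<in>{a..a + 2 * pi}. ennreal (cmod (F (of_real \<sigma> * cis \<theta>)) / (cmod (of_real \<sigma> * cis \<theta> - z))\<^sup>2) \<partial>lborel)"
    by (simp add: add.commute)
qed

section \<open>Distances in polar coordinates and the Poisson bound for the derivative\<close>

lemma cmod_polar_diff_squared: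
  "(cmod (of_real \<sigma> * cis \<theta> - of_real s * cis t))\<^sup>2 = (\<sigma> - s)\<^sup>2 + 4 * \<sigma> * s * (sin ((\<theta> - t) / 2))\<^sup>2"
proof -
  have "of_real \<sigma> * cis \<theta> - of_real s * cis t = cis t * (of_real \<sigma> * cis (\<theta> - t) - of_real s)"
    by (simp add: algebra_simps cis_mult)
  then have "(cmod (of_real \<sigma> * cis \<theta> - of_real s * cis t))\<^sup>2 = (cmod (of_real \<sigma> * cis (\<theta> - t) - of_real s))\<^sup>2"
    by (simp add: norm_mult)
  also have "\<dots> = (\<sigma> * cos (\<theta> - t) - s)\<^sup>2 + (\<sigma> * sin (\<theta> - t))\<^sup>2"
    by (simp add: cmod_power2)
  also have "\<dots> = \<sigma>\<^sup>2 * ((sin (\<theta> - t))\<^sup>2 + (cos (\<theta> - t))\<^sup>2) + s\<^sup>2 - 2 * \<sigma> * s * cos (\<theta> - t)"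
    by algebra
  also have "\<dots> = \<sigma>\<^sup>2 + s\<^sup>2 - 2 * \<sigma> * s * cos (\<theta> - t)"
    by simp
  also have "cos (\<theta> - t) = 1 - 2 * (sin ((\<theta> - t) / 2))\<^sup>2"
  proof -
    have "2 * ((\<theta> - t) / 2) = \<theta> - t"
      by (simp add: field_simps)
    then show ?thesis
      using cos_double_sin[of "(\<theta> - t) / 2"] by metis
  qed
  finally show ?thesis
    by (simp add: power2_eq_square algebra_simps)
qed

text \<open>From sin u = 2 sin(u/2) cos(u/2): on [0, pi/4] the cosine is at least sqrt 2 / 2, and by
  the mean value theorem the sine is at least sqrt 2 / 2 times its argument. This gives a weak
  Jordan inequality, sin u \<ge> u/2 on [0, pi/2], applied to u = |x|/2.\<close>

lemma sin_half_squared_ge: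
  assumes "\<bar>x\<bar> \<le> pi"
  shows "(sin (x / 2))\<^sup>2 \<ge> x\<^sup>2 / 16"
proof -
  have *: "x / 2 \<le> sin x" if x: "0 \<le> x" "x \<le> pi / 2" for x :: real
  proof -
    define y where "y = x / 2"
    have y: "0 \<le> y" "y \<le> pi / 4"
      using x by (auto simp: y_def)
    have cos_ge: "sqrt 2 / 2 \<le> cos u" if "0 \<le> u" "u \<le> y" for u
    proof -
      have "cos (pi / 4) \<le> cos u"
        using that y pi_gt_zero by (intro cos_monotone_0_pi_le) linarith+
      then show ?thesis
        by (simp add: cos_45)
    qed
    have "sqrt 2 / 2 * y \<le> sin y"
    proof (cases "y = 0")
      case False
      then have "\<exists>z. 0 < z \<and> z < y \<and> sin y - sin 0 = (y - 0) * cos z"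
        using y by (intro MVT2) auto
      then obtain z where z: "0 < z" "z < y" "sin y = y * cos z"
        by auto
      have "y * (sqrt 2 / 2) \<le> y * cos z"
        using z y by (intro mult_left_mono cos_ge) auto
      then show ?thesis
        using z by (simp add: mult.commute)
    qed simp
    then have "(sqrt 2 / 2 * y) * (sqrt 2 / 2) \<le> sin y * cos y"
      using y by (intro mult_mono cos_ge) (auto intro!: sin_ge_zero)
    moreover have "(sqrt 2 / 2 * y) * (sqrt 2 / 2) = y / 2"
      by simp
    ultimately have "y / 2 \<le> sin y * cos y"
      by (simp only:)
    moreover have "sin x = 2 * (sin y * cos y)"
      using sin_double[of y] by (simp add: y_def)
    ultimately show ?thesis
      unfolding y_def by linarith
  qed
  have "\<bar>x / 4\<bar> \<le> \<bar>sin (x / 2)\<bar>"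
  proof (cases "x \<ge> 0")
    case True
    then show ?thesis
      using *[of "x / 2"] assms by auto
  next
    case False
    then show ?thesis
      using *[of "- x / 2"] assms by auto
  qed
  then have "\<bar>x / 4\<bar>\<^sup>2 \<le> \<bar>sin (x / 2)\<bar>\<^sup>2"
    by (intro power_mono) auto
  then show ?thesis
    by (simp add: power2_eq_square)
qed

text \<open>On the circle halfway to the boundary, the squared distance to the point dominates a
  multiple of (1 - r)^2 + (\<theta> - t)^2, the denominator of the kernel. For every
  \<open>t\<close> in [0, 2 pi] the interval [t - pi, t + pi] lies inside the cut-off.\<close>

lemma deriv_le_poisson_average:
  assumes f: "f holomorphic_on ball 0 1" and r: "0 \<le> r" "r < 1" and t: "t \<in> {0..2 * pi}"
  shows "ennreal ((1 - r) * cmod (deriv f (of_real r * cis t)))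
    \<le> 200 * (\<integral>\<^sup>+\<theta>. (ennreal (cmod (f (of_real ((1 + r) / 2) * cis \<theta>))) * indicator {-pi..3 * pi} \<theta>)
        * poisson_ker (1 - r) (\<theta> - t) \<partial>lborel)"
proof -
  define \<sigma> where "\<sigma> = (1 + r) / 2"
  define z where "z = of_real r * cis t"
  have \<sigma>: "r < \<sigma>" "\<sigma> < 1" "1 / 2 \<le> \<sigma>" "\<sigma> - r = (1 - r) / 2"
    using r by (auto simp: \<sigma>_def field_simps)
  have z: "cmod z < \<sigma>"
    using r \<sigma> by (simp add: z_def norm_mult)
  have kernel: "(1 - r) * (1 / (cmod (of_real \<sigma> * cis \<theta> - z))\<^sup>2) \<le> 200 * ((1 - r) / ((1 - r)\<^sup>2 + (\<theta> - t)\<^sup>2))"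
    if \<theta>: "\<theta> \<in> {t - pi..t - pi + 2 * pi}" for \<theta>
  proof -
    define x where "x = \<theta> - t"
    have x: "\<bar>x\<bar> \<le> pi"
      using \<theta> by (auto simp: x_def)
    have s: "(sin (x / 2))\<^sup>2 \<ge> x\<^sup>2 / 16"
      by (rule sin_half_squared_ge[OF x])
    have eq: "(cmod (of_real \<sigma> * cis \<theta> - z))\<^sup>2 = ((1 - r) / 2)\<^sup>2 + 4 * \<sigma> * r * (sin (x / 2))\<^sup>2"
      unfolding z_def cmod_polar_diff_squared \<sigma>(4) x_def ..
    have "((1 - r)\<^sup>2 + x\<^sup>2) / 200 \<le> ((1 - r) / 2)\<^sup>2 + 4 * \<sigma> * r * (sin (x / 2))\<^sup>2"
    \<comment> \<open>For small \<open>r\<close> the angular term carries the factor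
      \<open>r\<close> and is of no help, but then 1 - r > 3/4 outweighs |x| < 4. The constant 200
      leaves room in both cases.\<close>
    proof (cases "r \<ge> 1 / 4")
      case True
      have "x\<^sup>2 / 32 = 4 * (1 / 2) * (1 / 4) * (x\<^sup>2 / 16)"
        by simp
      also have "\<dots> \<le> 4 * \<sigma> * r * (sin (x / 2))\<^sup>2"
        using True \<sigma> s by (intro mult_mono) auto
      finally have "x\<^sup>2 / 32 \<le> 4 * \<sigma> * r * (sin (x / 2))\<^sup>2" .
      moreover have "x\<^sup>2 \<ge> 0" "(1 - r)\<^sup>2 \<ge> 0" by simp_all
      moreover have "((1 - r) / 2)\<^sup>2 = (1 - r)\<^sup>2 / 4"
        by (simp add: power_divide)
      ultimately show ?thesis
        by (simp only: add_divide_distrib)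
    next
      case False
      have "x\<^sup>2 \<le> 4\<^sup>2"
        using x pi_less_4 by (intro power2_le_iff_abs_le[THEN iffD2]) auto
      moreover have "(3 / 4)\<^sup>2 \<le> (1 - r)\<^sup>2"
        using False by (intro power_mono) auto
      moreover have "((1 - r) / 2)\<^sup>2 = (1 - r)\<^sup>2 / 4"
        by (simp add: power_divide)
      moreover have "4 * \<sigma> * r * (sin (x / 2))\<^sup>2 \<ge> 0"
        using r \<sigma> by simp
      ultimately show ?thesis
        by (simp add: power2_eq_square[of "3/4"])
    qed
    then have "1 / (cmod (of_real \<sigma> * cis \<theta> - z))\<^sup>2 \<le> 1 / (((1 - r)\<^sup>2 + x\<^sup>2) / 200)"
      unfolding eq using r by (intro divide_left_mono) (auto intro!: mult_pos_pos add_pos_nonneg simp: \<sigma>_def)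
    then have "(1 - r) * (1 / (cmod (of_real \<sigma> * cis \<theta> - z))\<^sup>2) \<le> (1 - r) * (1 / (((1 - r)\<^sup>2 + x\<^sup>2) / 200))"
      using r by (intro mult_left_mono) auto
    then show ?thesis
      by (simp add: x_def mult.commute)
  qed
  define u where "u \<theta> = cmod (f (of_real \<sigma> * cis \<theta>))" for \<theta>
  have contu: "continuous_on UNIV u"
    unfolding u_def
    by (intro continuous_intros continuous_on_compose2[OF holomorphic_on_imp_continuous_on[OF f]])
       (use r \<sigma> in \<open>auto simp: norm_mult\<close>)
  then have [measurable]: "u \<in> borel_measurable borel"
    by (rule borel_measurable_continuous_onI)
  have [measurable]: "(\<lambda>\<theta>. cmod (of_real \<sigma> * cis \<theta> - z)) \<in> borel_measurable borel"
    by (intro borel_measurable_continuous_onI continuous_intros)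
  have "ennreal ((1 - r) * cmod (deriv f z)) = ennreal (1 - r) * ennreal (cmod (deriv f z))"
    using r by (simp add: ennreal_mult)
  also have "\<dots> \<le> ennreal (1 - r) *
      (\<integral>\<^sup>+\<theta>\<in>{t - pi..t - pi + 2 * pi}. ennreal (u \<theta> / (cmod (of_real \<sigma> * cis \<theta> - z))\<^sup>2) \<partial>lborel)"
    unfolding u_def by (intro mult_left_mono Cauchy_bounds_circle(2)[OF f z \<sigma>(2)]) simp
  also have "\<dots> = (\<integral>\<^sup>+\<theta>. ennreal (1 - r) *
      (ennreal (u \<theta> / (cmod (of_real \<sigma> * cis \<theta> - z))\<^sup>2) * indicator {t - pi..t - pi + 2 * pi} \<theta>) \<partial>lborel)"
    by (rule nn_integral_cmult[symmetric]) measurable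
  also have "\<dots> \<le> (\<integral>\<^sup>+\<theta>. 200 * ((ennreal (u \<theta>) * indicator {-pi..3 * pi} \<theta>) * poisson_ker (1 - r) (\<theta> - t)) \<partial>lborel)"
  proof (rule nn_integral_mono)
    fix \<theta>
    show "ennreal (1 - r) * (ennreal (u \<theta> / (cmod (of_real \<sigma> * cis \<theta> - z))\<^sup>2) * indicator {t - pi..t - pi + 2 * pi} \<theta>)
        \<le> 200 * ((ennreal (u \<theta>) * indicator {-pi..3 * pi} \<theta>) * poisson_ker (1 - r) (\<theta> - t))"
    proof (cases "\<theta> \<in> {t - pi..t - pi + 2 * pi}")
      case True
      then have "\<theta> \<in> {-pi..3 * pi}"
        using t by auto
      have "u \<theta> * ((1 - r) * (1 / (cmod (of_real \<sigma> * cis \<theta> - z))\<^sup>2)) \<le> u \<theta> * (200 * ((1 - r) / ((1 - r)\<^sup>2 + (\<theta> - t)\<^sup>2)))"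
        by (intro mult_left_mono kernel True) (simp add: u_def)
      then have "ennreal ((1 - r) * (u \<theta> / (cmod (of_real \<sigma> * cis \<theta> - z))\<^sup>2))
          \<le> ennreal (200 * (u \<theta> * ((1 - r) / ((1 - r)\<^sup>2 + (\<theta> - t)\<^sup>2))))"
        by (intro ennreal_leI) (simp add: mult_ac)
      also have "ennreal (200 * (u \<theta> * ((1 - r) / ((1 - r)\<^sup>2 + (\<theta> - t)\<^sup>2))))
          = 200 * (ennreal (u \<theta>) * ennreal ((1 - r) / ((1 - r)\<^sup>2 + (\<theta> - t)\<^sup>2)))"
        using r by (subst ennreal_mult, simp, simp add: u_def) (subst ennreal_mult, auto simp: u_def)
      also have "ennreal ((1 - r) * (u \<theta> / (cmod (of_real \<sigma> * cis \<theta> - z))\<^sup>2))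
          = ennreal (1 - r) * ennreal (u \<theta> / (cmod (of_real \<sigma> * cis \<theta> - z))\<^sup>2)"
        using r by (intro ennreal_mult) (auto simp: u_def)
      finally show ?thesis
        using True \<open>\<theta> \<in> {-pi..3 * pi}\<close> by (simp add: poisson_ker_def)
    qed auto
  qed
  also have "\<dots> = 200 * (\<integral>\<^sup>+\<theta>. (ennreal (u \<theta>) * indicator {-pi..3 * pi} \<theta>) * poisson_ker (1 - r) (\<theta> - t) \<partial>lborel)"
    by (rule nn_integral_cmult) measurable
  finally show ?thesis
    by (simp add: z_def u_def \<sigma>_def)
qed

subsection \<open>The tangential maximal function\<close>

text \<open>Peetre's trick: \<open>N\<close> is a tangential maximal function of \<open>f\<close> with quadratic weights; the
  reproducing formula with the extra factor \<open>((1 - |z|\<^sup>2) / (1 - cnj z * w))\<^sup>2\<close>, whose kernel decays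
  cubically, bounds \<open>N\<close> by \<open>sqrt N\<close> times a maximal function of the square root of the radial bound \<open>U\<close>.\<close>

lemma tangential_maximal_kernel_bound:
  assumes f: "f holomorphic_on ball 0 1"
    and N: "\<And>w. cmod w < 1 \<Longrightarrow> cmod (f w) * ((1 - cmod w) / cmod (cis t - w))\<^sup>2 \<le> N"
    and z: "cmod z < 1" and \<sigma>: "\<sigma> = (1 + cmod z) / 2" and \<theta>: "\<bar>\<theta> - t\<bar> \<le> pi"
  shows "cmod (f (of_real \<sigma> * cis \<theta>) * ((1 - (cmod z)\<^sup>2) / (1 - cnj z * (of_real \<sigma> * cis \<theta>)))\<^sup>2)
      / cmod (of_real \<sigma> * cis \<theta> - z)
    \<le> 2688 * sqrt N * (cmod (z - cis t) / (1 - cmod z))\<^sup>2 *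
      (sqrt (cmod (f (of_real \<sigma> * cis \<theta>))) * (cmod (z - cis t) / ((cmod (z - cis t))\<^sup>2 + (\<theta> - t)\<^sup>2)))"
proof -
  define w where "w = of_real \<sigma> * cis \<theta>"
  define d where "d = 1 - cmod z"
  define D where "D = cmod (z - cis t)"
  define E where "E = cmod (w - cis t)"
  define l where "l = cmod (w - z)"
  define A where "A = cmod (f w)"
  define x where "x = \<theta> - t"
  have \<sigma>': "1 - \<sigma> = d / 2" "1 / 2 \<le> \<sigma>" "\<sigma> < 1" "\<sigma> - cmod z = d / 2"
    using z by (auto simp: \<sigma> d_def field_simps)
  have N0: "N \<ge> 0"
    using order.trans[OF _ N[OF z]] by simp
  have cw: "cmod w = \<sigma>"
    using \<sigma>'(2) by (simp add: w_def norm_mult)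
  have d: "d > 0" "d \<le> 1"
    using z by (auto simp: d_def)
  have D: "d \<le> D"
    using norm_triangle_ineq2[of "cis t" z] by (simp add: D_def d_def norm_minus_commute)
  have E: "d / 2 \<le> E"
    using norm_triangle_ineq2[of "cis t" w] \<sigma>'(1) by (simp add: E_def cw norm_minus_commute)
  have l: "d / 2 \<le> l"
    using norm_triangle_ineq2[of w z] \<sigma>'(4) by (simp add: l_def cw)
  have pos: "D > 0" "E > 0" "l > 0"
    using d D E l by linarith+
  have E_le: "E \<le> l + D"
    using norm_triangle_ineq[of "w - z" "z - cis t"] by (simp add: E_def l_def D_def)
  \<comment> \<open>Only half of |f(w)| is traded for \<open>N\<close>; the other factor
    \<open>sqrt A\<close> is kept for the radial bound.\<close>
  have A: "sqrt A \<le> sqrt N * (2 * E / d)"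
  proof -
    have "A * ((d / 2) / E)\<^sup>2 \<le> N"
      using N[of w] \<sigma>'(1,3) by (simp add: A_def cw E_def norm_minus_commute)
    then have "sqrt (A * ((d / 2) / E)\<^sup>2) \<le> sqrt N"
      by (rule real_sqrt_le_mono)
    then have "sqrt A * ((d / 2) / E) \<le> sqrt N"
      using d pos by (simp add: real_sqrt_mult)
    then show ?thesis
      using d pos by (simp add: field_simps)
  qed
  \<comment> \<open>The identity behind the pseudohyperbolic distance: the difference of the two
    squares is (1 - |z|^2)(1 - |w|^2).\<close>
  have denom: "l \<le> cmod (1 - cnj z * w)"
  proof -
    have "(cmod (1 - cnj z * w))\<^sup>2 - l\<^sup>2 = (1 - (cmod z)\<^sup>2) * (1 - (cmod w)\<^sup>2)"
      unfolding l_def by (simp add: cmod_power2 algebra_simps) (simp add: power2_eq_square algebra_simps)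
    also have "\<dots> \<ge> 0"
      using z cw \<sigma>'(2,3) by (intro mult_nonneg_nonneg) (auto simp: power_le_one)
    finally have "l\<^sup>2 \<le> (cmod (1 - cnj z * w))\<^sup>2"
      by linarith
    then show ?thesis
      by (rule power2_le_imp_le) simp
  qed
  have numer: "1 - (cmod z)\<^sup>2 \<le> 2 * d"
  proof -
    have "1 - (cmod z)\<^sup>2 = (1 + cmod z) * d"
      by (simp add: d_def power2_eq_square algebra_simps)
    also have "\<dots> \<le> 2 * d"
      using z d by (intro mult_right_mono) auto
    finally show ?thesis .
  qed
  have factor: "cmod (((1 - (cmod z)\<^sup>2) / (1 - cnj z * w))\<^sup>2) \<le> (2 * d / l)\<^sup>2"
  proof -
    have "cmod (1 - (of_real (cmod z))\<^sup>2) = 1 - (cmod z)\<^sup>2"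
    proof -
      have "1 - (of_real (cmod z))\<^sup>2 = complex_of_real (1 - (cmod z)\<^sup>2)"
        by simp
      moreover have "0 \<le> 1 - (cmod z)\<^sup>2"
        using z by (simp add: power_le_one)
      ultimately show ?thesis
        by (simp only: norm_of_real abs_of_nonneg)
    qed
    then have "cmod ((1 - (of_real (cmod z))\<^sup>2) / (1 - cnj z * w)) \<le> 2 * d / l"
      unfolding norm_divide using numer denom pos d by (intro frac_le) auto
    then show ?thesis
      unfolding norm_power by (intro power_mono) auto
  qed
  have E_ge: "x\<^sup>2 / 8 \<le> E\<^sup>2"
  proof -
    have "E\<^sup>2 = (\<sigma> - 1)\<^sup>2 + 4 * \<sigma> * 1 * (sin (x / 2))\<^sup>2"
      using cmod_polar_diff_squared[of \<sigma> \<theta> 1 t] by (simp add: E_def w_def x_def)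
    moreover have "4 * (1 / 2) * 1 * (x\<^sup>2 / 16) \<le> 4 * \<sigma> * 1 * (sin (x / 2))\<^sup>2"
      using \<sigma>'(2) \<theta> by (intro mult_mono sin_half_squared_ge) (auto simp: x_def)
    moreover have "(\<sigma> - 1)\<^sup>2 \<ge> 0"
      by simp
    ultimately show ?thesis
      by linarith
  qed
  \<comment> \<open>Turns 1/l^2 into a Poisson kernel of width \<open>D\<close>. From x^2 \<le> 8
    E^2 and E^2 \<le> 2 l^2 + 2 D^2 comes 24 D^2 + 16 l^2; then d \<le> 2 l and d \<le> D give 24 *
    4 + 16 = 112.\<close>
  have decay: "1 / l\<^sup>2 \<le> 112 * D\<^sup>2 / (d\<^sup>2 * (D\<^sup>2 + x\<^sup>2))"
  proof -
    have "D\<^sup>2 + x\<^sup>2 \<le> 8 * (D\<^sup>2 + E\<^sup>2)"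
    proof -
      have "D\<^sup>2 + x\<^sup>2 \<le> 8 * D\<^sup>2 + 8 * E\<^sup>2"
        using E_ge zero_le_power2[of D] by (intro add_mono) (simp_all add: field_simps)
      then show ?thesis by (simp add: algebra_simps)
    qed
    moreover have "E\<^sup>2 \<le> 2 * l\<^sup>2 + 2 * D\<^sup>2"
    proof -
      have "E\<^sup>2 \<le> (l + D)\<^sup>2"
        using E_le pos by (intro power_mono) auto
      also have "\<dots> \<le> 2 * l\<^sup>2 + 2 * D\<^sup>2"
        using sum_squares_bound[of l D] by (simp add: power2_sum)
      finally show ?thesis .
    qed
    ultimately have "d\<^sup>2 * (D\<^sup>2 + x\<^sup>2) \<le> d\<^sup>2 * (24 * D\<^sup>2 + 16 * l\<^sup>2)"
      by (intro mult_left_mono) auto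
    also have "\<dots> = 24 * (d\<^sup>2 * D\<^sup>2) + 16 * (d\<^sup>2 * l\<^sup>2)"
      by (simp add: algebra_simps)
    also have "\<dots> \<le> 24 * ((2 * l)\<^sup>2 * D\<^sup>2) + 16 * (D\<^sup>2 * l\<^sup>2)"
      using d D l by (intro add_mono mult_left_mono mult_right_mono power_mono) auto
    also have "\<dots> = 112 * D\<^sup>2 * l\<^sup>2"
      by (simp add: power_mult_distrib)
    finally show ?thesis
      using d pos by (simp add: field_simps add_pos_nonneg)
  qed
  have "cmod (f w * ((1 - (cmod z)\<^sup>2) / (1 - cnj z * w))\<^sup>2) / l
      = sqrt A * sqrt A * cmod (((1 - (cmod z)\<^sup>2) / (1 - cnj z * w))\<^sup>2) / l"
    by (simp add: norm_mult A_def)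
  also have "\<dots> \<le> sqrt A * (sqrt N * (2 * E / d)) * (2 * d / l)\<^sup>2 / l"
    using A factor pos d N0 by (intro divide_right_mono mult_mono) (auto simp: A_def)
  \<comment> \<open>One of the three factors 1/l pays for \<open>E\<close>; the 3 comes from d \<le>
    D and d \<le> 2 l. Then 2 * 3 * 4 = 24, and 24 * 112 = 2688.\<close>
  also have "\<dots> \<le> sqrt A * (sqrt N * (2 * (3 * D * l / d) / d)) * (2 * d / l)\<^sup>2 / l"
  proof -
    have "E \<le> 3 * D * l / d"
    proof -
      have "l * d \<le> l * D" "D * d \<le> D * (2 * l)"
        using D l pos by (intro mult_left_mono; simp)+
      then have "(l + D) * d \<le> 3 * D * l"
        by (simp add: algebra_simps)
      then have "l + D \<le> 3 * D * l / d"
        using d by (simp add: field_simps)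
      then show ?thesis
        using E_le by linarith
    qed
    then show ?thesis
      using d pos N0 by (intro divide_right_mono mult_right_mono mult_left_mono) (auto simp: A_def)
  qed
  also have "\<dots> = 24 * (sqrt A * sqrt N * D) * (1 / l\<^sup>2)"
    using d pos by (simp add: field_simps power2_eq_square)
  also have "\<dots> \<le> 24 * (sqrt A * sqrt N * D) * (112 * D\<^sup>2 / (d\<^sup>2 * (D\<^sup>2 + x\<^sup>2)))"
    using pos N0 by (intro mult_left_mono decay) (auto simp: A_def)
  also have "\<dots> = 2688 * sqrt N * (D / d)\<^sup>2 * (sqrt A * (D / (D\<^sup>2 + x\<^sup>2)))"
    by (simp add: power_divide)
  finally show ?thesis
    by (simp only: w_def[symmetric] A_def D_def d_def l_def x_def)
qed

text \<open>With m the value of the maximal function, the supremum \<open>N\<close> satisfies N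
  \<le> 43008 m sqrt N. The bound \<open>B\<close> makes \<open>N\<close> finite, so that sqrt N can
  be cancelled, and does not enter the result.\<close>

lemma deriv_le_maximal_fun_of_bounded:
  assumes f: "f holomorphic_on ball 0 1"
    and B: "\<And>w. cmod w < 1 \<Longrightarrow> cmod (f w) \<le> B"
    and [measurable]: "U \<in> borel_measurable borel"
    and U: "\<And>s \<theta>. 0 \<le> s \<Longrightarrow> s < 1 \<Longrightarrow> ennreal (cmod (f (of_real s * cis \<theta>))) \<le> U \<theta>"
    and t: "t \<in> {0..2 * pi}" and r: "0 \<le> r" "r < 1"
  shows "ennreal ((1 - r) * cmod (deriv f (of_real r * cis t)))
    \<le> ennreal (18 * 43008\<^sup>2) *
      ennpowr (maximal_fun (\<lambda>\<theta>. ennpowr (U \<theta>) (1/2) * indicator {-pi..3 * pi} \<theta>) t) 2"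
proof -
  define W where "W = (\<lambda>\<theta>. ennpowr (U \<theta>) (1/2) * indicator {-pi..3 * pi} \<theta>)"
  have [measurable]: "W \<in> borel_measurable borel"
    unfolding W_def by measurable
  show ?thesis
  proof (cases "maximal_fun W t")
    case (real m)
    \<comment> \<open>The weight is 1 on the radius towards \<open>cis t\<close> and comparable to 1
      near it, so \<open>N\<close> controls \<open>f\<close> there.\<close>
    define g where "g w = cmod (f w) * ((1 - cmod w) / cmod (cis t - w))\<^sup>2" for w
    define N where "N = (SUP w\<in>ball 0 1. g w)"
    have g_le: "g w \<le> B" if w: "cmod w < 1" for w
    proof -
      have "1 - cmod w \<le> cmod (cis t - w)"
        using norm_triangle_ineq2[of "cis t" w] by simp
      then have "(1 - cmod w) / cmod (cis t - w) \<le> 1"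
        using w by (intro divide_le_eq_1_pos[THEN iffD2]) linarith+
      then have "((1 - cmod w) / cmod (cis t - w))\<^sup>2 \<le> 1"
        using w by (intro power_le_one) auto
      then have "g w \<le> cmod (f w)"
        unfolding g_def by (intro mult_left_le) auto
      then show ?thesis
        using B[OF w] by linarith
    qed
    have gN: "g w \<le> N" if "cmod w < 1" for w
      unfolding N_def using that g_le by (intro cSUP_upper bdd_aboveI2[of _ _ B]) auto
    have N0: "N \<ge> 0"
    proof -
      have "0 \<le> g 0"
        by (simp add: g_def)
      then show ?thesis
        using gN[of 0] by simp
    qed
    have key: "g z \<le> 43008 * m * sqrt N" if z: "cmod z < 1" for z
    proof -
      define \<sigma> where "\<sigma> = (1 + cmod z) / 2"
      define D where "D = cmod (z - cis t)"
      define d where "d = 1 - cmod z"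
      define c where "c = 2688 * sqrt N * (D / d)\<^sup>2"
      \<comment> \<open>The extra factor is 1 at \<open>w = z\<close>. On the circle its decay
        compensates for the growth of sqrt |f| allowed by \<open>N\<close>, and still leaves a
        Poisson kernel.\<close>
      define F where "F w = f w * ((1 - (cmod z)\<^sup>2) / (1 - cnj z * w))\<^sup>2" for w
      have \<sigma>: "cmod z < \<sigma>" "\<sigma> < 1" "\<sigma> > 0"
        using z norm_ge_zero[of z] by (auto simp: \<sigma>_def intro: add_pos_nonneg simp del: norm_ge_zero)
      have d: "d > 0"
        using z by (simp add: d_def)
      have D: "D \<ge> d"
        using norm_triangle_ineq2[of "cis t" z] by (simp add: D_def d_def norm_minus_commute)
      have c: "c \<ge> 0"
        using N0 by (simp add: c_def)
      have ne: "1 - cnj z * w \<noteq> 0" if "cmod w < 1" for w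
      proof
        assume "1 - cnj z * w = 0"
        then have "cmod (cnj z * w) = 1" by simp
        moreover have "cmod z * cmod w < 1 * 1"
          using that z by (intro mult_strict_mono') auto
        ultimately show False by (simp add: norm_mult)
      qed
      have F: "F holomorphic_on ball 0 1"
        unfolding F_def by (intro holomorphic_intros f) (use ne in auto)
      have "1 - cnj z * z = of_real (1 - (cmod z)\<^sup>2)"
        by (simp add: complex_norm_square mult.commute del: of_real_power)
      then have Fz: "F z = f z"
        using ne[OF z] by (simp add: F_def)
      have "ennreal (cmod (F z)) \<le> (\<integral>\<^sup>+\<theta>\<in>{t - pi..t - pi + 2 * pi}.
          ennreal (cmod (F (of_real \<sigma> * cis \<theta>)) / cmod (of_real \<sigma> * cis \<theta> - z)) \<partial>lborel)"
        by (rule Cauchy_bounds_circle(1)[OF F \<sigma>(1,2)])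
      also have "\<dots> \<le> (\<integral>\<^sup>+\<theta>. ennreal c * (W \<theta> * poisson_ker D (\<theta> - t)) \<partial>lborel)"
      proof (rule nn_integral_mono)
        fix \<theta>
        show "ennreal (cmod (F (of_real \<sigma> * cis \<theta>)) / cmod (of_real \<sigma> * cis \<theta> - z)) * indicator {t - pi..t - pi + 2 * pi} \<theta>
            \<le> ennreal c * (W \<theta> * poisson_ker D (\<theta> - t))"
        proof (cases "\<theta> \<in> {t - pi..t - pi + 2 * pi}")
          case True
          then have \<theta>: "\<bar>\<theta> - t\<bar> \<le> pi" "\<theta> \<in> {-pi..3 * pi}"
            using t by auto
          have sqrtU: "ennreal (sqrt (cmod (f (of_real \<sigma> * cis \<theta>)))) \<le> W \<theta>"
            using ennpowr_mono[OF U[of \<sigma> \<theta>], of "1/2"] \<theta>(2) \<sigma>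
            by (simp add: W_def ennpowr_ennreal powr_half_sqrt)
          have "cmod (F (of_real \<sigma> * cis \<theta>)) / cmod (of_real \<sigma> * cis \<theta> - z)
              \<le> c * (sqrt (cmod (f (of_real \<sigma> * cis \<theta>))) * (D / (D\<^sup>2 + (\<theta> - t)\<^sup>2)))"
            unfolding F_def c_def D_def d_def
            by (rule tangential_maximal_kernel_bound[OF f gN[unfolded g_def] z \<sigma>_def \<theta>(1)])
          then have "ennreal (cmod (F (of_real \<sigma> * cis \<theta>)) / cmod (of_real \<sigma> * cis \<theta> - z))
              \<le> ennreal (c * (sqrt (cmod (f (of_real \<sigma> * cis \<theta>))) * (D / (D\<^sup>2 + (\<theta> - t)\<^sup>2))))"
            by (rule ennreal_leI)
          also have "\<dots> = ennreal c * (ennreal (sqrt (cmod (f (of_real \<sigma> * cis \<theta>)))) * poisson_ker D (\<theta> - t))"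
            unfolding poisson_ker_def using c D d by (subst ennreal_mult, simp, simp) (subst ennreal_mult, auto)
          also have "\<dots> \<le> ennreal c * (W \<theta> * poisson_ker D (\<theta> - t))"
            by (intro mult_left_mono mult_right_mono sqrtU) auto
          finally show ?thesis
            using True by simp
        qed simp
      qed
      also have "\<dots> = ennreal c * (\<integral>\<^sup>+\<theta>. W \<theta> * poisson_ker D (\<theta> - t) \<partial>lborel)"
        by (rule nn_integral_cmult) measurable
      also have "\<dots> \<le> ennreal c * (16 * maximal_fun W t)"
        by (intro mult_left_mono poisson_ker_convolution_le_maximal_fun) auto
      also have "\<dots> = ennreal (c * (16 * m))"
        using c real by (simp add: ennreal_mult)
      finally have "cmod (f z) \<le> c * (16 * m)"
        unfolding Fz using c real by (subst (asm) ennreal_le_iff) auto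
      \<comment> \<open>The weight in \<open>g\<close> cancels exactly the growth (D / d)^2
        contained in \<open>c\<close>; 43008 = 16 * 2688.\<close>
      then have "g z \<le> (c * (16 * m)) * (d / D)\<^sup>2"
        unfolding g_def d_def D_def norm_minus_commute[of "cis t"] by (rule mult_right_mono) simp
      also have "\<dots> = 43008 * m * sqrt N * ((D / d)\<^sup>2 * (d / D)\<^sup>2)"
        by (simp add: c_def)
      also have "(D / d)\<^sup>2 * (d / D)\<^sup>2 = 1"
        using d D by (simp add: power_mult_distrib[symmetric])
      finally show ?thesis by simp
    qed
    have N_le: "N \<le> (43008 * m)\<^sup>2"
    proof (cases "N = 0")
      case False
      with N0 have "sqrt N > 0" by simp
      have "N \<le> 43008 * m * sqrt N"
        unfolding N_def by (intro cSUP_least) (use key N_def in auto)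
      then have "sqrt N * sqrt N \<le> 43008 * m * sqrt N"
        using N0 by simp
      then have "sqrt N \<le> 43008 * m"
        using \<open>sqrt N > 0\<close> by (simp only: mult_le_cancel_right_pos)
      then have "(sqrt N)\<^sup>2 \<le> (43008 * m)\<^sup>2"
        using N0 by (intro power_mono) auto
      then show ?thesis
        using N0 by simp
    qed simp
    define z where "z = of_real r * cis t"
    define d where "d = 1 - r"
    have d: "d > 0" and cz: "cmod z = r"
      using r by (auto simp: d_def z_def norm_mult)
    have zt: "cmod (cis t - z) = d"
    proof -
      have "cis t - z = of_real d * cis t"
        by (simp add: z_def d_def algebra_simps)
      then show ?thesis
        using d by (simp add: norm_mult)
    qed
    have sub: "cball z (d / 2) \<subseteq> ball 0 1"
    proof
      fix w assume "w \<in> cball z (d / 2)"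
      then have "cmod w \<le> r + d / 2"
        using norm_triangle_ineq2[of w z] cz by (simp add: dist_norm norm_minus_commute)
      then show "w \<in> ball 0 1"
        using d by (simp add: d_def field_simps)
    qed
    \<comment> \<open>On this circle 1 - |w| \<ge> d/2 and |cis t - w| \<le> 3 d/2, so the squared
      weight is at least 1/9. Dividing by the radius d/2 turns 9 into 18.\<close>
    have "cmod ((deriv ^^ 1) f z) \<le> fact 1 * (9 * N) / (d / 2) ^ 1"
    proof (rule Cauchy_inequality)
      show "f holomorphic_on ball z (d / 2)"
        using sub by (intro holomorphic_on_subset[OF f]) (auto simp: subset_iff)
      show "continuous_on (cball z (d / 2)) f"
        by (intro holomorphic_on_imp_continuous_on holomorphic_on_subset[OF f] sub)
      show "0 < d / 2" using d by simp
      fix w assume w: "cmod (z - w) = d / 2"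
      then have w1: "cmod w < 1"
        using sub by (auto simp: dist_norm subset_iff)
      have "d / 2 \<le> 1 - cmod w"
        using norm_triangle_ineq2[of w z] w cz by (simp add: norm_minus_commute d_def field_simps)
      moreover have "cmod (cis t - w) \<le> 3 * d / 2"
        using norm_triangle_ineq[of "cis t - z" "z - w"] w zt by simp
      moreover have "cmod (cis t - w) > 0"
        using w1 by auto
      ultimately have "1 / 3 \<le> (1 - cmod w) / cmod (cis t - w)"
        by (simp add: field_simps)
      then have "(1 / 3)\<^sup>2 \<le> ((1 - cmod w) / cmod (cis t - w))\<^sup>2"
        by (intro power_mono) auto
      then have "cmod (f w) * (1 / 3)\<^sup>2 \<le> g w"
        unfolding g_def by (intro mult_left_mono) auto
      then show "cmod (f w) \<le> 9 * N"
        using gN[OF w1] by (simp add: power2_eq_square)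
    qed
    then have "(1 - r) * cmod (deriv f z) \<le> 18 * N"
      using d by (simp add: d_def field_simps)
    also have "\<dots> \<le> 18 * 43008\<^sup>2 * m\<^sup>2"
      using N_le by (simp add: power_mult_distrib)
    finally have "ennreal ((1 - r) * cmod (deriv f z)) \<le> ennreal (18 * 43008\<^sup>2 * m\<^sup>2)"
      by (rule ennreal_leI)
    also have "\<dots> = ennreal (18 * 43008\<^sup>2) * ennpowr (ennreal m) 2"
      using real by (simp add: ennpowr_ennreal ennreal_mult)
    finally show ?thesis
      unfolding z_def W_def[symmetric] real(2) .
  next
    case top
    then show ?thesis
      unfolding W_def by (simp add: ennreal_mult_top)
  qed
qed

text \<open>The dilation z \<mapsto> f(\<rho> z) is bounded on the disc and inherits the radial
  bound \<open>U\<close>. With \<rho> = (1 + r)/2 one has \<rho> - r = (1 - r)/2, so only a factor 2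
  is lost: 36 = 2 * 18.\<close>

lemma deriv_le_maximal_fun:
  assumes f: "f holomorphic_on ball 0 1"
    and [measurable]: "U \<in> borel_measurable borel"
    and U: "\<And>s \<theta>. 0 \<le> s \<Longrightarrow> s < 1 \<Longrightarrow> ennreal (cmod (f (of_real s * cis \<theta>))) \<le> U \<theta>"
    and t: "t \<in> {0..2 * pi}" and r: "0 \<le> r" "r < 1"
  shows "ennreal ((1 - r) * cmod (deriv f (of_real r * cis t)))
    \<le> ennreal (36 * 43008\<^sup>2) *
      ennpowr (maximal_fun (\<lambda>\<theta>. ennpowr (U \<theta>) (1/2) * indicator {-pi..3 * pi} \<theta>) t) 2"
proof -
  define \<rho> where "\<rho> = (1 + r) / 2"
  have \<rho>: "0 < \<rho>" "\<rho> < 1" "r / \<rho> < 1" "0 \<le> r / \<rho>" "\<rho> - r = (1 - r) / 2"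
    using r by (auto simp: \<rho>_def field_simps)
  define F where "F z = f (of_real \<rho> * z)" for z
  have in_ball: "cmod (of_real \<rho> * z) < \<rho>" if "cmod z < 1" for z
    using that \<rho> by (simp add: norm_mult)
  have F: "F holomorphic_on ball 0 1"
    unfolding F_def
    by (intro holomorphic_on_compose_gen[OF _ f, unfolded o_def] holomorphic_intros)
       (use less_trans[OF in_ball \<rho>(2)] in auto)
  have "compact (f ` cball 0 \<rho>)"
    by (intro compact_continuous_image holomorphic_on_imp_continuous_on holomorphic_on_subset[OF f])
       (use \<rho> in auto)
  then obtain B where B: "\<And>w. w \<in> cball 0 \<rho> \<Longrightarrow> cmod (f w) \<le> B"
    by (meson bounded_iff compact_imp_bounded imageI)
  define z where "z = of_real (r / \<rho>) * cis t"
  have \<rho>z: "of_real \<rho> * z = of_real r * cis t"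
    using \<rho> by (simp add: z_def)
  have "(f has_field_derivative deriv f (of_real \<rho> * z)) (at (of_real \<rho> * z))"
    unfolding \<rho>z by (rule holomorphic_derivI[OF f]) (use r in \<open>auto simp: norm_mult\<close>)
  then have "(F has_field_derivative deriv f (of_real \<rho> * z) * of_real \<rho>) (at z)"
    unfolding F_def by (rule DERIV_chain2) (auto intro!: derivative_eq_intros)
  then have "deriv F z = deriv f (of_real r * cis t) * of_real \<rho>"
    unfolding \<rho>z by (rule DERIV_imp_deriv)
  then have "(1 - r / \<rho>) * cmod (deriv F z) = (\<rho> - r) * cmod (deriv f (of_real r * cis t))"
    using \<rho> by (simp add: norm_mult field_simps)
  also have "\<dots> = (1 - r) * cmod (deriv f (of_real r * cis t)) / 2"
    unfolding \<rho>(5) by simp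
  finally have eq: "(1 - r) * cmod (deriv f (of_real r * cis t)) = 2 * ((1 - r / \<rho>) * cmod (deriv F z))"
    by linarith
  have "ennreal ((1 - r / \<rho>) * cmod (deriv F z)) \<le> ennreal (18 * 43008\<^sup>2) *
      ennpowr (maximal_fun (\<lambda>\<theta>. ennpowr (U \<theta>) (1/2) * indicator {-pi..3 * pi} \<theta>) t) 2"
    unfolding z_def
  proof (rule deriv_le_maximal_fun_of_bounded[OF F])
    show "cmod (F w) \<le> B" if "cmod w < 1" for w
      unfolding F_def using in_ball[OF that] by (intro B) auto
    show "ennreal (cmod (F (of_real s * cis \<theta>))) \<le> U \<theta>" if s: "0 \<le> s" "s < 1" for s \<theta>
    proof -
      have "\<rho> * s < 1 * 1"
        using s \<rho> by (intro mult_strict_mono') auto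
      then show ?thesis
        using U[of "\<rho> * s" \<theta>] s \<rho> by (simp add: F_def mult.assoc)
    qed
  qed (use t \<rho> in auto)
  then have "2 * ennreal ((1 - r / \<rho>) * cmod (deriv F z)) \<le> 2 * (ennreal (18 * 43008\<^sup>2) *
      ennpowr (maximal_fun (\<lambda>\<theta>. ennpowr (U \<theta>) (1/2) * indicator {-pi..3 * pi} \<theta>) t) 2)"
    by (rule mult_left_mono) simp
  moreover have "ennreal (2 * X) = 2 * ennreal X" for X
    by (simp add: ennreal_mult')
  moreover have "ennreal (36 * 43008\<^sup>2) = 2 * ennreal (18 * 43008\<^sup>2)"
    by (subst ennreal_numeral[symmetric], subst ennreal_mult[symmetric]) auto
  ultimately show ?thesis
    unfolding eq by (simp only: mult.assoc)
qed

subsection \<open>Norm inequalities\<close>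

text \<open>The set where \<open>u\<close> exceeds its essential supremum is relatively open. If it
  had a point, it would contain a nonempty open set, as \<open>S\<close> lies in the closure of its
  interior, and such a set is not negligible. The condition on \<open>S\<close> admits [0,1), which
  is not open.\<close>

lemma continuous_le_esssup:
  fixes u :: "'a::euclidean_space \<Rightarrow> real"
  assumes S: "S \<in> sets lebesgue" "S \<subseteq> closure (interior S)"
    and u: "continuous_on S u" and x: "x \<in> S"
  shows "ennreal (u x) \<le> esssup (lebesgue_on S) (\<lambda>x. ennreal (u x))"
proof (rule ccontr)
  define E where "E = esssup (lebesgue_on S) (\<lambda>x. ennreal (u x))"
  assume "\<not> ?thesis"
  then have xE: "E < ennreal (u x)"
    by (simp add: E_def)
  have "continuous_on S (\<lambda>y. ennreal (u y))"
    by (intro continuous_on_ennreal u)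
  then have "openin (top_of_set S) (S \<inter> (\<lambda>y. ennreal (u y)) -` {E<..})"
    by (rule continuous_openin_preimage_gen) simp
  then obtain T where T: "open T" "S \<inter> (\<lambda>y. ennreal (u y)) -` {E<..} = S \<inter> T"
    by (auto simp: openin_open)
  then have "x \<in> T"
    using x xE by auto
  then have "T \<inter> closure (interior S) \<noteq> {}"
    using x S(2) by auto
  then have "T \<inter> interior S \<noteq> {}"
    using T(1) by (simp add: open_Int_closure_eq_empty)
  moreover have "open (T \<inter> interior S)"
    using T(1) by auto
  ultimately have "\<not> negligible (T \<inter> interior S)"
    by (intro open_not_negligible)
  have "AE y in lebesgue_on S. ennreal (u y) \<le> E"
    unfolding E_def by (rule esssup_AE)
  then have "AE y in lebesgue. y \<in> S \<longrightarrow> ennreal (u y) \<le> E"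
    using S(1) by (subst (asm) AE_restrict_space_iff) auto
  then obtain N where N: "{y. \<not> (y \<in> S \<longrightarrow> ennreal (u y) \<le> E)} \<subseteq> N" "N \<in> null_sets lebesgue"
    by (auto simp: eventually_ae_filter)
  have "T \<inter> interior S \<subseteq> N"
    using T(2) N(1) interior_subset[of S] by fastforce
  then have "negligible (T \<inter> interior S)"
    using N(2) negligible_iff_null_sets negligible_subset by blast
  then show False
    using \<open>\<not> negligible (T \<inter> interior S)\<close> by contradiction
qed

lemma continuous_on_radius:
  assumes "continuous_on (ball 0 1) h"
  shows "continuous_on {0..<1} (\<lambda>r. cmod (h (of_real r * cis t)))"
  by (intro continuous_intros continuous_on_compose2[OF assms]) (auto simp: norm_mult)

lemma radial_norm_infinity:
  assumes h: "continuous_on (ball 0 1) h"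
  shows "radial_norm \<infinity> h t = (SUP r\<in>{0..<1}. ennreal (cmod (h (of_real r * cis t))))"
proof -
  have m: "(\<lambda>r. ennreal (cmod (h (of_real r * cis t)))) \<in> borel_measurable (lebesgue_on {0..<1})"
    by (intro measurable_compose[OF continuous_imp_measurable_on_sets_lebesgue[OF continuous_on_radius[OF h]] measurable_ennreal]) auto
  have "esssup (lebesgue_on {0..<1}) (\<lambda>r. ennreal (cmod (h (of_real r * cis t))))
      = (SUP r\<in>{0..<1}. ennreal (cmod (h (of_real r * cis t))))"
  proof (intro antisym SUP_least)
    show "esssup (lebesgue_on {0..<1}) (\<lambda>r. ennreal (cmod (h (of_real r * cis t))))
        \<le> (SUP r\<in>{0..<1}. ennreal (cmod (h (of_real r * cis t))))"
      by (intro esssup_I m AE_I2 SUP_upper) auto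
    fix r :: real assume "r \<in> {0..<1}"
    then show "ennreal (cmod (h (of_real r * cis t))) \<le> esssup (lebesgue_on {0..<1}) (\<lambda>r. ennreal (cmod (h (of_real r * cis t))))"
      by (intro continuous_le_esssup continuous_on_radius[OF h]) auto
  qed
  then show ?thesis
    by (simp add: radial_norm_def)
qed

lemma continuous_on_angle:
  assumes "continuous_on (ball 0 1) h" "r \<in> {0..<1}"
  shows "continuous_on UNIV (\<lambda>t. cmod (h (of_real r * cis t)))"
  using assms(2) by (intro continuous_intros continuous_on_compose2[OF assms(1)]) (auto simp: norm_mult)

text \<open>A supremum of continuous functions of the angle is lower semicontinuous.\<close>

lemma measurable_radial_norm_infinity:
  assumes h: "continuous_on (ball 0 1) h"
  shows "radial_norm \<infinity> h \<in> borel_measurable borel"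
proof (rule borel_measurableI_greater)
  fix y
  have "{t \<in> space borel. y < radial_norm \<infinity> h t} = (\<Union>r\<in>{0..<1}. {t. y < ennreal (cmod (h (of_real r * cis t)))})"
    unfolding radial_norm_infinity[OF h] by (auto simp: less_SUP_iff)
  also have "open \<dots>"
    by (intro open_UN ballI open_Collect_less continuous_on_ennreal continuous_on_angle[OF h] continuous_on_const)
  finally show "{t \<in> space borel. y < radial_norm \<infinity> h t} \<in> sets borel"
    by (rule borel_open)
qed

section \<open>Periodicity and the passage from integrals to \<open>rho\<close>\<close>

lemma nn_integral_lebesgue_on:
  assumes "S \<in> sets borel"
  shows "(\<integral>\<^sup>+x. g x \<partial>lebesgue_on S) = (\<integral>\<^sup>+x\<in>S. g x \<partial>lborel)"
  using assms by (subst nn_integral_restrict_space) (auto simp: nn_integral_completion)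

text \<open>The interval is only two periods long, but covering it by periods that start at
  multiples of 2 pi takes three.\<close>

lemma nn_integral_periodic_three_periods:
  fixes u :: "real \<Rightarrow> ennreal"
  assumes [measurable]: "u \<in> borel_measurable borel" and per: "\<And>t. u (t + 2 * pi) = u t"
  shows "(\<integral>\<^sup>+t\<in>{-pi..3 * pi}. u t \<partial>lborel) \<le> 3 * (\<integral>\<^sup>+t\<in>{0..2 * pi}. u t \<partial>lborel)"
proof -
  have "(\<integral>\<^sup>+t\<in>{-pi..3 * pi}. u t \<partial>lborel)
      \<le> (\<integral>\<^sup>+t. u t * indicator {-(2*pi)..0} t + (u t * indicator {0..2*pi} t + u t * indicator {2*pi..4*pi} t) \<partial>lborel)"
    by (intro nn_integral_mono) (auto simp: indicator_def)
  also have "\<dots> = (\<integral>\<^sup>+t\<in>{-(2*pi)..0}. u t \<partial>lborel)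
      + ((\<integral>\<^sup>+t\<in>{0..2*pi}. u t \<partial>lborel) + (\<integral>\<^sup>+t\<in>{2*pi..4*pi}. u t \<partial>lborel))"
    by (simp add: nn_integral_add)
  also have "(\<integral>\<^sup>+t\<in>{-(2*pi)..0}. u t \<partial>lborel) = (\<integral>\<^sup>+t\<in>{0..2*pi}. u t \<partial>lborel)"
    using nn_integral_shift_interval[of u "2*pi" "-(2*pi)" 0] by (simp add: per)
  also have "(\<integral>\<^sup>+t\<in>{2*pi..4*pi}. u t \<partial>lborel) = (\<integral>\<^sup>+t\<in>{0..2*pi}. u t \<partial>lborel)"
    using nn_integral_shift_interval[of u "2*pi" 0 "2*pi", symmetric] by (simp add: per)
  also have "(\<integral>\<^sup>+t\<in>{0..2*pi}. u t \<partial>lborel) + ((\<integral>\<^sup>+t\<in>{0..2*pi}. u t \<partial>lborel) + (\<integral>\<^sup>+t\<in>{0..2*pi}. u t \<partial>lborel))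
      = (1 + (1 + 1)) * (\<integral>\<^sup>+t\<in>{0..2*pi}. u t \<partial>lborel)"
    by (simp only: distrib_right mult_1)
  also have "1 + (1 + 1) = (3 :: ennreal)"
    by simp
  finally show ?thesis .
qed

lemma cis_periodic: "cis (t + 2 * pi) = cis t"
  by (simp add: cis.ctr)

lemma rho_le_of_integral_le:
  assumes Q: "Q > 0" and K: "K > 0"
    and le: "(\<integral>\<^sup>+t\<in>{0..2 * pi}. ennpowr (radial_norm p h t) Q \<partial>lborel)
      \<le> ennreal K * (\<integral>\<^sup>+t\<in>{0..2 * pi}. ennpowr (radial_norm p f t) Q \<partial>lborel)"
  shows "rho p (ennreal Q) h \<le> ennreal (K powr (1/Q)) * rho p (ennreal Q) f"
proof -
  define J where "J g = (\<integral>\<^sup>+t\<in>{0..2 * pi}. ennpowr (radial_norm p g t) Q \<partial>lborel)" for g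
  have rho: "rho p (ennreal Q) g = ennpowr (ennreal (1 / (2 * pi)) * J g) (1/Q)" for g
    using Q by (simp add: rho_def J_def nn_integral_lebesgue_on)
  have "rho p (ennreal Q) h \<le> ennpowr (ennreal (1 / (2 * pi)) * (ennreal K * J f)) (1/Q)"
    unfolding rho using le Q by (intro ennpowr_mono mult_left_mono) (auto simp: J_def)
  also have "\<dots> = ennreal (K powr (1/Q)) * rho p (ennreal Q) f"
    using K by (simp add: rho ennpowr_mult ennpowr_ennreal mult_ac)
  finally show ?thesis .
qed

section \<open>The weighted derivative in the three ranges of exponents\<close>

abbreviation weighted_deriv :: "(complex \<Rightarrow> complex) \<Rightarrow> complex \<Rightarrow> complex" where
  "weighted_deriv f \<equiv> \<lambda>z. deriv f z * of_real (1 - cmod z)"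

lemma cmod_weighted_deriv:
  assumes "0 \<le> r" "r < 1"
  shows "cmod (weighted_deriv f (of_real r * cis t)) = (1 - r) * cmod (deriv f (of_real r * cis t))"
proof -
  have "cmod (complex_of_real (1 - r)) = 1 - r"
    unfolding norm_of_real using assms by simp
  then show ?thesis
    using assms by (simp add: norm_mult mult.commute del: of_real_diff)
qed

lemma continuous_on_weighted_deriv:
  assumes "f holomorphic_on ball 0 1"
  shows "continuous_on (ball 0 1) (weighted_deriv f)"
  by (intro continuous_intros holomorphic_on_imp_continuous_on holomorphic_deriv assms) auto

text \<open>The substitution s = (1 + r)/2 maps [0,1) onto [1/2,1) with dr = 2 ds. It undoes the
  outward shift of the radius caused by Cauchy's formula.\<close>

lemma nn_integral_half_shift_le:
  fixes u :: "real \<Rightarrow> ennreal"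
  assumes [measurable]: "(\<lambda>r. u r * indicator {0..<1} r) \<in> borel_measurable borel"
  shows "(\<integral>\<^sup>+r\<in>{0..<1}. u ((1 + r) / 2) \<partial>lborel) \<le> 2 * (\<integral>\<^sup>+r\<in>{0..<1}. u r \<partial>lborel)"
proof -
  have "(\<integral>\<^sup>+r\<in>{0..<1}. u r \<partial>lborel)
      = ennreal (1/2) * (\<integral>\<^sup>+r. u (1/2 + 1/2 * r) * indicator {0..<1} (1/2 + 1/2 * r) \<partial>lborel)"
    by (subst nn_integral_real_affine[where c = "1/2" and t = "1/2"]) auto
  then have "2 * (\<integral>\<^sup>+r\<in>{0..<1}. u r \<partial>lborel)
      = (2 * ennreal (1/2)) * (\<integral>\<^sup>+r. u (1/2 + 1/2 * r) * indicator {0..<1} (1/2 + 1/2 * r) \<partial>lborel)"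
    by (simp only: mult.assoc)
  also have "2 * ennreal (1/2) = 1"
    by (subst ennreal_numeral[symmetric], subst ennreal_mult[symmetric]) auto
  finally have eq: "2 * (\<integral>\<^sup>+r\<in>{0..<1}. u r \<partial>lborel)
      = (\<integral>\<^sup>+r. u (1/2 + 1/2 * r) * indicator {0..<1} (1/2 + 1/2 * r) \<partial>lborel)"
    by simp
  show ?thesis
    unfolding eq
  proof (rule nn_integral_mono)
    fix r :: real
    have half: "(1 + r) / 2 = 1/2 + 1/2 * r"
      by (simp add: field_simps)
    show "u ((1 + r) / 2) * indicator {0..<1} r \<le> u (1/2 + 1/2 * r) * indicator {0..<1} (1/2 + 1/2 * r)"
      unfolding half by (auto simp: indicator_def)
  qed
qed

lemma measurable_polar_disc:
  assumes f: "continuous_on (ball 0 1) f"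
  shows "(\<lambda>(r, t). ennreal (cmod (f (of_real r * cis t))) * indicator {0..<1} r) \<in> borel_measurable (borel \<Otimes>\<^sub>M borel)"
proof -
  let ?A = "{0..<1 :: real} \<times> (UNIV :: real set)"
  have "?A \<in> sets borel"
    by (intro borel_Times) auto
  moreover have "continuous_on ?A (\<lambda>x. cmod (f (of_real (fst x) * cis (snd x))))"
    by (intro continuous_intros continuous_on_compose2[OF f]) (auto simp: norm_mult)
  ultimately have "(\<lambda>x. indicator ?A x *\<^sub>R cmod (f (of_real (fst x) * cis (snd x)))) \<in> borel_measurable borel"
    by (rule borel_measurable_continuous_on_indicator)
  then have "(\<lambda>x. ennreal (indicator ?A x *\<^sub>R cmod (f (of_real (fst x) * cis (snd x))))) \<in> borel_measurable borel"
    by measurable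
  also have "(\<lambda>x. ennreal (indicator ?A x *\<^sub>R cmod (f (of_real (fst x) * cis (snd x)))))
      = (\<lambda>(r, t). ennreal (cmod (f (of_real r * cis t))) * indicator {0..<1} r)"
    by (auto simp: fun_eq_iff indicator_def)
  finally show ?thesis
    by (simp add: borel_prod)
qed

lemma rho_finite_deriv:
  assumes PQ: "(1 < P \<and> 1 < Q) \<or> (P = 1 \<and> 1 \<le> Q)"
  obtains C where "C > 0"
    "\<And>f. f holomorphic_on ball 0 1 \<Longrightarrow>
      rho (ennreal P) (ennreal Q) (weighted_deriv f) \<le> ennreal C * rho (ennreal P) (ennreal Q) f"
proof -
  have P: "1 \<le> P" and Q: "1 \<le> Q"
    using PQ by auto
  \<comment> \<open>Built on \<open>lborel\<close> to suit Borel product measurability;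
    \<open>nn_integral_lebesgue_on\<close> matches it with the \<open>lebesgue_on\<close> in
    \<open>rho\<close>.\<close>
  define M where "M = restrict_space lborel {0..<1::real}"
  interpret M: finite_measure M
    by (rule finite_measureI) (simp add: M_def emeasure_restrict_space space_restrict_space)
  have sets_M: "f \<in> measurable borel N \<Longrightarrow> f \<in> measurable M N" for f :: "real \<Rightarrow> 'b" and N
    unfolding M_def by (rule measurable_restrict_space1) simp
  interpret mixed_norm M "\<lambda>r. 1 - r"
    by unfold_locales (rule sets_M, measurable)
  have int_M: "(\<integral>\<^sup>+r. g r \<partial>M) = (\<integral>\<^sup>+r\<in>{0..<1}. g r \<partial>lborel)" for g
    unfolding M_def by (rule nn_integral_restrict_space) simp
  obtain C0 where C0: "C0 > 0"
    "\<And>a. case_prod a \<in> borel_measurable (M \<Otimes>\<^sub>M borel) \<Longrightarrow> mixed P Q (avg a) \<le> ennreal C0 * mixed P Q a"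
  proof (cases "P \<le> Q")
    case True
    then show ?thesis
      using avg_bounded_increasing_exponents[OF P] that by blast
  next
    \<comment> \<open>Now \<open>Q < P\<close>, which rules out \<open>P = 1\<close>, so
      \<open>1 < Q\<close> as the duality requires.\<close>
    case False
    then show ?thesis
      using avg_bounded_decreasing_exponents[of Q P] PQ that by (metis linorder_not_le)
  qed
  \<comment> \<open>The factors come from the pointwise Cauchy bound, the averaging operator, the
    shift of the radius and the three periods.\<close>
  define K where "K = 200 powr Q * C0 * 2 powr (Q / P) * 3"
  have K: "K > 0"
    using C0(1) by (simp add: K_def)
  have pow_norm: "ennpowr (radial_norm (ennreal P) h t) Q
      = ennpowr (\<integral>\<^sup>+r. ennpowr (ennreal (cmod (h (of_real r * cis t)))) P \<partial>M) (Q / P)" for h t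
    using P by (simp add: radial_norm_def ennpowr_ennpowr ennpowr_ennreal nn_integral_lebesgue_on int_M)
  have "rho (ennreal P) (ennreal Q) (weighted_deriv f) \<le> ennreal (K powr (1/Q)) * rho (ennreal P) (ennreal Q) f"
    if f: "f holomorphic_on ball 0 1" for f
  proof (rule rho_le_of_integral_le)
    have contf: "continuous_on (ball 0 1) f"
      by (rule holomorphic_on_imp_continuous_on[OF f])
    define F where "F r t = ennreal (cmod (f (of_real r * cis t))) * indicator {0..<1} r" for r t
    have F [measurable]: "(\<lambda>x. F (fst x) (snd x)) \<in> borel_measurable (borel \<Otimes>\<^sub>M borel)"
      using measurable_polar_disc[OF contf] by (simp add: F_def case_prod_beta')
    have [measurable]: "(\<lambda>r. F r t) \<in> borel_measurable borel" for t
      using measurable_compose[OF measurable_Pair2'[of t borel borel] F] by simp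
    define a where "a r t = F ((1 + r) / 2) t * indicator {-pi..3 * pi} t" for r t
    have fst_M [measurable]: "fst \<in> measurable (M \<Otimes>\<^sub>M borel) borel"
      by (rule measurable_compose[OF measurable_fst]) (simp add: sets_M)
    have a: "case_prod a \<in> borel_measurable (M \<Otimes>\<^sub>M borel)"
    proof -
      have "(\<lambda>x. ((1 + fst x) / 2, snd x)) \<in> measurable (M \<Otimes>\<^sub>M borel) (borel \<Otimes>\<^sub>M borel)"
        by measurable
      from measurable_compose[OF this F] have [measurable]:
        "(\<lambda>x. F ((1 + fst x) / 2) (snd x)) \<in> borel_measurable (M \<Otimes>\<^sub>M borel)"
        by simp
      show ?thesis
        unfolding a_def case_prod_beta' by measurable
    qed
    define \<psi> where "\<psi> t = ennpowr (\<integral>\<^sup>+r\<in>{0..<1}. ennpowr (F r t) P \<partial>lborel) (Q / P)" for t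
    have \<psi> [measurable]: "\<psi> \<in> borel_measurable borel"
    proof -
      have [measurable]: "(\<lambda>(t, r). F r t) \<in> borel_measurable (borel \<Otimes>\<^sub>M lborel)"
        using measurable_compose[OF measurable_pair_swap' F] by (simp add: case_prod_beta')
      show ?thesis
        unfolding \<psi>_def by measurable
    qed
    have \<psi>_eq: "\<psi> t = ennpowr (radial_norm (ennreal P) f t) Q" for t
      unfolding pow_norm int_M \<psi>_def F_def
      by (intro arg_cong2[where f = ennpowr] nn_integral_cong) (auto simp: indicator_def)
    have "(\<integral>\<^sup>+t\<in>{0..2 * pi}. ennpowr (radial_norm (ennreal P) (weighted_deriv f) t) Q \<partial>lborel)
        \<le> (\<integral>\<^sup>+t. ennpowr (\<integral>\<^sup>+r. ennpowr (200 * avg a r t) P \<partial>M) (Q / P) \<partial>lborel)"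
    proof (rule nn_integral_mono)
      fix t
      show "ennpowr (radial_norm (ennreal P) (weighted_deriv f) t) Q * indicator {0..2 * pi} t
          \<le> ennpowr (\<integral>\<^sup>+r. ennpowr (200 * avg a r t) P \<partial>M) (Q / P)"
      proof (cases "t \<in> {0..2 * pi}")
        case True
        have "ennpowr (radial_norm (ennreal P) (weighted_deriv f) t) Q
            \<le> ennpowr (\<integral>\<^sup>+r. ennpowr (200 * avg a r t) P \<partial>M) (Q / P)"
          unfolding pow_norm
        proof (intro ennpowr_mono nn_integral_mono)
          fix r assume "r \<in> space M"
          then have r: "0 \<le> r" "r < 1"
            by (auto simp: M_def space_restrict_space)
          show "ennreal (cmod (weighted_deriv f (of_real r * cis t))) \<le> 200 * avg a r t"
            using deriv_le_poisson_average[OF f r True] r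
            unfolding cmod_weighted_deriv[OF r] avg_def a_def F_def by simp
        qed (use P Q in auto)
        then show ?thesis
          using True by simp
      qed simp
    qed
    also have "\<dots> = (\<integral>\<^sup>+t. ennreal (200 powr Q) * ennpowr (\<integral>\<^sup>+r. ennpowr (avg a r t) P \<partial>M) (Q / P) \<partial>lborel)"
    proof (rule nn_integral_cong)
      fix t :: real
      have [measurable]: "(\<lambda>r. avg a r t) \<in> borel_measurable M"
        using measurable_compose[OF measurable_Pair2' measurable_avg[OF a], of t] by simp
      have "(\<integral>\<^sup>+r. ennpowr (200 * avg a r t) P \<partial>M) = ennreal (200 powr P) * (\<integral>\<^sup>+r. ennpowr (avg a r t) P \<partial>M)"
        using ennpowr_ennreal[of 200 P] by (simp add: ennpowr_mult nn_integral_cmult)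
      then show "ennpowr (\<integral>\<^sup>+r. ennpowr (200 * avg a r t) P \<partial>M) (Q / P)
          = ennreal (200 powr Q) * ennpowr (\<integral>\<^sup>+r. ennpowr (avg a r t) P \<partial>M) (Q / P)"
        using P by (simp add: ennpowr_mult ennpowr_ennreal powr_powr)
    qed
    also have "\<dots> = ennreal (200 powr Q) * mixed P Q (avg a)"
    proof -
      have [measurable]: "case_prod (avg a) \<in> borel_measurable (M \<Otimes>\<^sub>M borel)"
        by (rule measurable_avg[OF a])
      show ?thesis
        unfolding mixed_def by (rule nn_integral_cmult) measurable
    qed
    also have "\<dots> \<le> ennreal (200 powr Q) * (ennreal C0 * mixed P Q a)"
      by (intro mult_left_mono C0(2) a) simp
    also have "mixed P Q a \<le> (\<integral>\<^sup>+t. ennreal (2 powr (Q / P)) * (\<psi> t * indicator {-pi..3 * pi} t) \<partial>lborel)"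
      unfolding mixed_def
    proof (rule nn_integral_mono)
      fix t
      show "ennpowr (\<integral>\<^sup>+r. ennpowr (a r t) P \<partial>M) (Q / P)
          \<le> ennreal (2 powr (Q / P)) * (\<psi> t * indicator {-pi..3 * pi} t)"
      proof (cases "t \<in> {-pi..3 * pi}")
        case True
        have "(\<integral>\<^sup>+r. ennpowr (a r t) P \<partial>M) = (\<integral>\<^sup>+r\<in>{0..<1}. ennpowr (F ((1 + r) / 2) t) P \<partial>lborel)"
          using True by (simp add: int_M a_def)
        also have "\<dots> \<le> 2 * (\<integral>\<^sup>+r\<in>{0..<1}. ennpowr (F r t) P \<partial>lborel)"
          by (rule nn_integral_half_shift_le) measurable
        finally have "ennpowr (\<integral>\<^sup>+r. ennpowr (a r t) P \<partial>M) (Q / P)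
            \<le> ennpowr (2 * (\<integral>\<^sup>+r\<in>{0..<1}. ennpowr (F r t) P \<partial>lborel)) (Q / P)"
          using P Q by (intro ennpowr_mono) auto
        also have "\<dots> = ennreal (2 powr (Q / P)) * \<psi> t"
          using ennpowr_ennreal[of 2 "Q / P"] by (simp add: ennpowr_mult \<psi>_def)
        finally show ?thesis
          using True by simp
      qed (simp add: a_def)
    qed
    also have "\<dots> = ennreal (2 powr (Q / P)) * (\<integral>\<^sup>+t\<in>{-pi..3 * pi}. \<psi> t \<partial>lborel)"
      by (rule nn_integral_cmult) measurable
    also have "(\<integral>\<^sup>+t\<in>{-pi..3 * pi}. \<psi> t \<partial>lborel) \<le> 3 * (\<integral>\<^sup>+t\<in>{0..2 * pi}. \<psi> t \<partial>lborel)"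
      by (intro nn_integral_periodic_three_periods \<psi>) (simp only: \<psi>_def F_def cis_periodic)
    finally show "(\<integral>\<^sup>+t\<in>{0..2 * pi}. ennpowr (radial_norm (ennreal P) (weighted_deriv f) t) Q \<partial>lborel)
        \<le> ennreal K * (\<integral>\<^sup>+t\<in>{0..2 * pi}. ennpowr (radial_norm (ennreal P) f t) Q \<partial>lborel)"
      using C0(1) by (simp add: K_def \<psi>_eq ennreal_mult mult.assoc mult_left_mono)
  qed (use Q K in auto)
  moreover have "K powr (1/Q) > 0"
    using K by simp
  ultimately show ?thesis
    using that by blast
qed

text \<open>By continuity a finite essential supremum bounds \<open>f\<close> everywhere, and
  Cauchy's estimate on the disc of radius (1 - |z|)/2 about z gives the factor 2.\<close>

lemma rho_infinity_infinity_deriv: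
  assumes f: "f holomorphic_on ball 0 1"
  shows "rho \<infinity> \<infinity> (weighted_deriv f) \<le> ennreal 2 * rho \<infinity> \<infinity> f"
proof (cases "rho \<infinity> \<infinity> f")
  case (real A)
  have contf: "continuous_on (ball 0 1) f"
    by (rule holomorphic_on_imp_continuous_on[OF f])
  have A: "cmod (f w) \<le> A" if "cmod w < 1" for w
  proof -
    have "ennreal (cmod (f w)) \<le> esssup (lebesgue_on (ball 0 1)) (\<lambda>z. ennreal (cmod (f z)))"
      using that by (intro continuous_le_esssup continuous_intros contf) auto
    also have "\<dots> = ennreal A"
      using real by (simp add: rho_def)
    finally show ?thesis
      using real by simp
  qed
  have bound: "cmod (weighted_deriv f z) \<le> 2 * A" if z: "cmod z < 1" for z
  proof -
    define d where "d = 1 - cmod z"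
    have d: "d > 0"
      using z by (simp add: d_def)
    have sub: "cball z (d / 2) \<subseteq> ball 0 1"
    proof
      fix w assume "w \<in> cball z (d / 2)"
      then have "cmod w \<le> cmod z + d / 2"
        using norm_triangle_ineq2[of w z] by (simp add: dist_norm norm_minus_commute)
      then show "w \<in> ball 0 1"
        using d by (simp add: d_def field_simps)
    qed
    have "cmod ((deriv ^^ 1) f z) \<le> fact 1 * A / (d / 2) ^ 1"
    proof (rule Cauchy_inequality)
      show "f holomorphic_on ball z (d / 2)"
        using sub by (intro holomorphic_on_subset[OF f]) (auto simp: subset_iff)
      show "continuous_on (cball z (d / 2)) f"
        by (intro holomorphic_on_imp_continuous_on holomorphic_on_subset[OF f] sub)
      show "0 < d / 2" using d by simp
      fix w assume "cmod (z - w) = d / 2"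
      then show "cmod (f w) \<le> A"
        using sub by (intro A) (auto simp: dist_norm subset_iff)
    qed
    then have "cmod (deriv f z) * d \<le> 2 * A"
      using d by (simp add: field_simps)
    moreover have "cmod (weighted_deriv f z) = cmod (deriv f z) * d"
      using d unfolding norm_mult d_def[symmetric] by simp
    ultimately show ?thesis by simp
  qed
  have m: "(\<lambda>z. ennreal (cmod (weighted_deriv f z))) \<in> borel_measurable (lebesgue_on (ball 0 1))"
    by (intro measurable_compose[OF continuous_imp_measurable_on_sets_lebesgue measurable_ennreal]
          continuous_on_norm continuous_on_weighted_deriv f) auto
  have "rho \<infinity> \<infinity> (weighted_deriv f) = esssup (lebesgue_on (ball 0 1)) (\<lambda>z. ennreal (cmod (weighted_deriv f z)))"
    by (simp add: rho_def)
  also have "\<dots> \<le> ennreal (2 * A)"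
    by (intro esssup_I m AE_I2 ennreal_leI bound) auto
  finally show ?thesis
    using real by (simp add: ennreal_mult)
qed (simp add: ennreal_mult_top)

text \<open>The square in the pointwise bound doubles the exponent to 2 Q, and since
  \<open>W\<close> is the cut-off square root of \<open>U\<close>, the integral of W^(2 Q) is that
  of U^Q over [-pi, 3 pi].\<close>

lemma rho_infinity_deriv:
  assumes Q: "1 \<le> Q"
  obtains C where "C > 0"
    "\<And>f. f holomorphic_on ball 0 1 \<Longrightarrow> rho \<infinity> (ennreal Q) (weighted_deriv f) \<le> ennreal C * rho \<infinity> (ennreal Q) f"
proof -
  define C0 :: real where "C0 = 36 * 43008\<^sup>2"
  define C1 where "C1 = 10 * (2 * Q) * 2 powr (2 * Q - 1) / (2 * Q - 1)"
  have C: "C0 > 0" "C1 > 0"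
    using Q by (auto simp: C0_def C1_def)
  define K where "K = C0 powr Q * C1 * 3"
  have "rho \<infinity> (ennreal Q) (weighted_deriv f) \<le> ennreal (K powr (1/Q)) * rho \<infinity> (ennreal Q) f"
    if f: "f holomorphic_on ball 0 1" for f
  proof (rule rho_le_of_integral_le)
    have contf: "continuous_on (ball 0 1) f"
      by (rule holomorphic_on_imp_continuous_on[OF f])
    define U where "U = radial_norm \<infinity> f"
    have [measurable]: "U \<in> borel_measurable borel"
      unfolding U_def by (rule measurable_radial_norm_infinity[OF contf])
    have U_periodic: "U (t + 2 * pi) = U t" for t
      unfolding U_def radial_norm_infinity[OF contf] cis_periodic ..
    have U_ge: "ennreal (cmod (f (of_real s * cis \<theta>))) \<le> U \<theta>" if "0 \<le> s" "s < 1" for s \<theta>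
      unfolding U_def radial_norm_infinity[OF contf] using that by (intro SUP_upper) auto
    define W where "W = (\<lambda>\<theta>. ennpowr (U \<theta>) (1/2) * indicator {-pi..3 * pi} \<theta>)"
    have [measurable]: "W \<in> borel_measurable borel"
      unfolding W_def by measurable
    have pointwise: "radial_norm \<infinity> (weighted_deriv f) t \<le> ennreal C0 * ennpowr (maximal_fun W t) 2"
      if t: "t \<in> {0..2 * pi}" for t
      unfolding radial_norm_infinity[OF continuous_on_weighted_deriv[OF f]]
    proof (rule SUP_least)
      fix r :: real assume "r \<in> {0..<1}"
      then have r: "0 \<le> r" "r < 1" by auto
      show "ennreal (cmod (weighted_deriv f (of_real r * cis t))) \<le> ennreal C0 * ennpowr (maximal_fun W t) 2"
        unfolding cmod_weighted_deriv[OF r] C0_def W_def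
        by (rule deriv_le_maximal_fun[OF f _ U_ge t r]) auto
    qed
    have "(\<integral>\<^sup>+t\<in>{0..2 * pi}. ennpowr (radial_norm \<infinity> (weighted_deriv f) t) Q \<partial>lborel)
        \<le> (\<integral>\<^sup>+t. ennreal (C0 powr Q) * ennpowr (maximal_fun W t) (2 * Q) \<partial>lborel)"
    proof (rule nn_integral_mono)
      fix t
      show "ennpowr (radial_norm \<infinity> (weighted_deriv f) t) Q * indicator {0..2 * pi} t
          \<le> ennreal (C0 powr Q) * ennpowr (maximal_fun W t) (2 * Q)"
      proof (cases "t \<in> {0..2 * pi}")
        case True
        have "ennpowr (radial_norm \<infinity> (weighted_deriv f) t) Q \<le> ennpowr (ennreal C0 * ennpowr (maximal_fun W t) 2) Q"
          using Q by (intro ennpowr_mono pointwise True) auto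
        then show ?thesis
          using True C by (simp add: ennpowr_mult ennpowr_ennpowr ennpowr_ennreal)
      qed simp
    qed
    also have "\<dots> = ennreal (C0 powr Q) * (\<integral>\<^sup>+t. ennpowr (maximal_fun W t) (2 * Q) \<partial>lborel)"
      by (rule nn_integral_cmult) measurable
    also have "\<dots> \<le> ennreal (C0 powr Q) * (ennreal C1 * (\<integral>\<^sup>+t. ennpowr (W t) (2 * Q) \<partial>lborel))"
      unfolding C1_def using Q by (intro mult_left_mono maximal_fun_strong_type) auto
    also have "(\<integral>\<^sup>+t. ennpowr (W t) (2 * Q) \<partial>lborel) = (\<integral>\<^sup>+t\<in>{-pi..3 * pi}. ennpowr (U t) Q \<partial>lborel)"
      by (intro nn_integral_cong) (auto simp: W_def indicator_def ennpowr_ennpowr)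
    also have "\<dots> \<le> 3 * (\<integral>\<^sup>+t\<in>{0..2 * pi}. ennpowr (U t) Q \<partial>lborel)"
      by (intro nn_integral_periodic_three_periods) (auto simp: U_periodic)
    finally show "(\<integral>\<^sup>+t\<in>{0..2 * pi}. ennpowr (radial_norm \<infinity> (weighted_deriv f) t) Q \<partial>lborel)
        \<le> ennreal K * (\<integral>\<^sup>+t\<in>{0..2 * pi}. ennpowr (radial_norm \<infinity> f t) Q \<partial>lborel)"
      using C by (simp add: K_def U_def ennreal_mult mult.assoc mult_left_mono)
  qed (use Q C in \<open>auto simp: K_def\<close>)
  moreover have "K powr (1/Q) > 0"
    using C by (simp add: K_def)
  ultimately show ?thesis
    using that by blast
qed

theorem proposition3p12:
  fixes p q :: ennreal
  assumes "(1 < p \<and> p < \<infinity> \<and> 1 < q \<and> q < \<infinity>)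
         \<or> (p = 1 \<and> 1 \<le> q \<and> q < \<infinity>)
         \<or> (p = \<infinity> \<and> 1 \<le> q \<and> q \<le> \<infinity>)"
  shows "\<exists>C::real. C > 0 \<and>
    (\<forall>f\<in>RM p q. rho p q (\<lambda>z. deriv f z * of_real (1 - cmod z)) \<le> ennreal C * rho p q f)"
proof -
  have "\<exists>C::real. C > 0 \<and> (\<forall>f. f holomorphic_on ball 0 1 \<longrightarrow> rho p q (weighted_deriv f) \<le> ennreal C * rho p q f)"
  proof (cases q)
    case top
    then have "p = \<infinity>" "q = \<infinity>"
      using assms by auto
    then show ?thesis
      using rho_infinity_infinity_deriv by (intro exI[of _ 2]) auto
  next
    case (real Q)
    have "1 \<le> q"
      using assms by (auto simp: less_imp_le)
    then have Q: "1 \<le> Q"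
      using real by simp
    show ?thesis
    proof (cases p)
      case top
      obtain C where "C > 0" "\<And>f. f holomorphic_on ball 0 1 \<Longrightarrow>
          rho \<infinity> (ennreal Q) (weighted_deriv f) \<le> ennreal C * rho \<infinity> (ennreal Q) f"
        by (rule rho_infinity_deriv[OF Q]) blast
      then show ?thesis
        unfolding top real(2) infinity_ennreal_def by blast
    next
      case p: (real P)
      have "(1 < P \<and> 1 < Q) \<or> (P = 1 \<and> 1 \<le> Q)"
        using assms p real Q ennreal_less_iff[of 1] by auto
      then obtain C where "C > 0" "\<And>f. f holomorphic_on ball 0 1 \<Longrightarrow>
          rho (ennreal P) (ennreal Q) (weighted_deriv f) \<le> ennreal C * rho (ennreal P) (ennreal Q) f"
        by (rule rho_finite_deriv) blast
      then show ?thesis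
        unfolding p(2) real(2) by blast
    qed
  qed
  then show ?thesis
    by (auto simp: RM_def)
qed

end
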